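(* Let $\mu_i$ ($i\in\mathbb N$) and $\mu$ be finite Borel measures on $S^{n-1}$ which are not concentrated on any closed hemisphere, with $\mu_i\to\mu$ weakly. Let $G\in\mathcal G_I$ be a continuous function such that, for some $q\ge n-1$, $$\inf\Big\{\frac{G(t,u)}{t^q}:\ t\ge 1,\ u\in S^{n-1}\Big\}>0,$$ and let $\varphi\in\mathcal I$. The following statements hold. i) If for each $i\in\mathbb N$ there exists $\widetilde M_i\in\widetilde{\mathcal B}$ such that $$\int_{S^{n-1}}\varphi(h_{\widetilde M_i}(u))\,d\mu_i(u)=\inf\Big\{\int_{S^{n-1}}\varphi(h_Q(u))\,d\mu_i(u):Q\in\widetilde{\mathcal B}\Big\},$$ then there exists $\widetilde M\in\widetilde{\mathcal B}$ such that $$\int_{S^{n-1}}\varphi(h_{\widetilde M}(u))\,d\mu(u)=\inf\Big\{\int_{S^{n-1}}\varphi(h_Q(u))\,d\mu(u):Q\in\widetilde{\mathcal B}\Big\}.$$ Moreover, $$\lim_{i\to\infty}\int_{S^{n-1}}\varphi(h_{\widetilde M_i}(u))\,d\mu_i(u)=\int_{S^{n-1}}\varphi(h_{\widetilde M}(u))\,d\mu(u).$$ ii) If for each $i\in\mathbb N$ there exists $\widehat M_i\in\widehat{\mathcal B}$ such that $$\int_{S^{n-1}}\varphi(h_{\widehat M_i}(u))\,d\mu_i(u)=\inf\Big\{\int_{S^{n-1}}\varphi(h_Q(u))\,d\mu_i(u):Q\in\widehat{\mathcal B}\Big\},$$ then there exists $\widehat M\in\widehat{\mathcal B}$ such that $$\int_{S^{n-1}}\varphi(h_{\widehat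 M}(u))\,d\mu(u)=\inf\Big\{\int_{S^{n-1}}\varphi(h_Q(u))\,d\mu(u):Q\in\widehat{\mathcal B}\Big\}.$$ Moreover, $$\lim_{i\to\infty}\int_{S^{n-1}}\varphi(h_{\widehat M_i}(u))\,d\mu_i(u)=\int_{S^{n-1}}\varphi(h_{\widehat M}(u))\,d\mu(u).$$
   Context: Work in $\mathbb R^n$, $n\ge2$, with inner product $\langle\cdot,\cdot\rangle$, unit ball $B^n$ and unit sphere $S^{n-1}$; $du$ denotes the spherical measure on $S^{n-1}$ (the $(n-1)$-dimensional Hausdorff measure). $\mathcal K_{(o)}^n$ is the set of compact convex subsets of $\mathbb R^n$ with the origin $o$ in their interiors. For $K\in\mathcal K_{(o)}^n$ and $u\in S^{n-1}$: $h_K(u)=\max_{x\in K}\langle x,u\rangle$, $\rho_K(u)=\max\{\lambda\ge0:\lambda u\in K\}$, and $K^\circ=\{x\in\mathbb R^n:\langle x,y\rangle\le1\ \forall y\in K\}$. $\mathcal I$ is the set of continuous strictly increasing functions $\varphi:(0,\infty)\to(0,\infty)$ with $\lim_{t\to0^+}\varphi(t)=0$, $\varphi(1)=1$, $\lim_{t\to\infty}\varphi(t)=\infty$. $\mathcal G_I$ is the set of continuous $G:(0,\infty)\times S^{n-1}\to(0,\infty)$ such that for each $u\in S^{n-1}$, $t\mapsto G(t,u)$ is strictly increasing with $\lim_{t\to0^+}G(t,u)=0$ and $\lim_{t\to\infty}G(t,u)=\infty$. The general dual volume is $\widetilde V_G(K)=\int_{S^{n-1}}G(\rho_K(u),u)\,du$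 for $K\in\mathcal K_{(o)}^n$. For $G\in\mathcal G_I$ the homogeneous general dual volume is $\widehat V_G(K)=\inf\{\eta>0:\int_{S^{n-1}}G(\rho_K(u)/\eta,u)\,du\le1\}$. Set $$\widetilde{\mathcal B}=\{Q\in\mathcal K_{(o)}^n:\widetilde V_G(Q^\circ)=\widetilde V_G(B^n)\},\qquad \widehat{\mathcal B}=\{Q\in\mathcal K_{(o)}^n:\widehat V_G(Q^\circ)=\widehat V_G(B^n)\}.$$ A finite Borel measure $\mu$ on $S^{n-1}$ is not concentrated on any closed hemisphere if $\mu(\{u\in S^{n-1}:\langle u,v\rangle>0\})>0$ for every $v\in S^{n-1}$. Weak convergence $\mu_i\to\mu$ means $\int f\,d\mu_i\to\int f\,d\mu$ for every continuous $f$ on $S^{n-1}$. *)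

theory Defs
  imports "HOL-Analysis.Analysis"
begin

text \<open>
  \<open>\<real>\<^sup>n\<close> is a type \<open>'a :: euclidean_space\<close> with \<open>n = DIM('a)\<close>; \<open>S\<^sup>n\<^sup>-\<^sup>1\<close> is \<open>sphere 0 1\<close> and
  \<open>B\<^sup>n\<close> is \<open>cball 0 1\<close>. Functions on \<open>(0,\<infinity>)\<close> are total functions on \<open>real\<close> of which only the
  values at positive arguments matter.
\<close>

text \<open>
  The \<open>m\<close>-dimensional Hausdorff measure, with the normalisation that agrees with Lebesgue measure
  on \<open>\<real>\<^sup>m\<close>. Boundedness of the covering sets is required because \<^const>\<open>diameter\<close> carries
  no information on unbounded sets; empty covering sets are given weight \<open>0\<close> also when
  \<open>m = 0\<close>. The outer measure is metric, hence countably additive on the Borel sets.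
\<close>

definition hausdorff_content :: "nat \<Rightarrow> real \<Rightarrow> 'a::euclidean_space set \<Rightarrow> ennreal" where
  "hausdorff_content m \<delta> A =
     (INF U \<in> {U :: nat \<Rightarrow> 'a set. A \<subseteq> (\<Union>j. U j) \<and> (\<forall>j. bounded (U j) \<and> diameter (U j) \<le> \<delta>)}.
        \<Sum>j. if U j = {} then 0
            else ennreal (unit_ball_vol (real m) * (diameter (U j) / 2) ^ m))"

definition hausdorff_outer :: "nat \<Rightarrow> 'a::euclidean_space set \<Rightarrow> ennreal" where
  "hausdorff_outer m A = (SUP \<delta> \<in> {0<..}. hausdorff_content m \<delta> A)"

definition hausdorff_measure :: "nat \<Rightarrow> 'a::euclidean_space measure" where
  "hausdorff_measure m = measure_of UNIV (sets borel) (hausdorff_outer m)"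

definition spherical_measure :: "'a::euclidean_space measure" where
  "spherical_measure = restrict_space (hausdorff_measure (DIM('a) - 1)) (sphere 0 1)"

definition bodies_o :: "'a::euclidean_space set set" where
  "bodies_o = {K. compact K \<and> convex K \<and> 0 \<in> interior K}"

text \<open>For \<open>K \<in> bodies_o\<close> and a unit vector \<open>u\<close>, both suprema are attained by compactness of \<open>K\<close>.\<close>

definition support_fun :: "'a::euclidean_space set \<Rightarrow> 'a \<Rightarrow> real" where
  "support_fun K u = (SUP x\<in>K. x \<bullet> u)"

definition radial_fun :: "'a::euclidean_space set \<Rightarrow> 'a \<Rightarrow> real" where
  "radial_fun K u = Sup {l. 0 \<le> l \<and> l *\<^sub>R u \<in> K}"

definition polar_body :: "'a::euclidean_space set \<Rightarrow> 'a set" where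
  "polar_body K = {x. \<forall>y\<in>K. x \<bullet> y \<le> 1}"

definition class_I :: "(real \<Rightarrow> real) set" where
  "class_I = {\<phi>. (\<forall>t>0. \<phi> t > 0) \<and> continuous_on {0<..} \<phi> \<and> strict_mono_on {0<..} \<phi> \<and>
     (\<phi> \<longlongrightarrow> 0) (at_right 0) \<and> \<phi> 1 = 1 \<and> filterlim \<phi> at_top at_top}"

definition class_GI :: "(real \<Rightarrow> 'a::euclidean_space \<Rightarrow> real) set" where
  "class_GI = {G. (\<forall>t>0. \<forall>u\<in>sphere 0 1. G t u > 0) \<and>
     continuous_on ({0<..} \<times> sphere 0 1) (\<lambda>(t, u). G t u) \<and>
     (\<forall>u\<in>sphere 0 1. strict_mono_on {0<..} (\<lambda>t. G t u) \<and>
        ((\<lambda>t. G t u) \<longlongrightarrow> 0) (at_right 0) \<and> filterlim (\<lambda>t. G t u) at_top at_top)}"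

text \<open>
  For \<open>K \<in> bodies_o\<close> and \<open>G \<in> class_GI\<close> the integrands below are continuous on the
  sphere, so the Bochner integrals never take their default value for non-integrable functions.
\<close>

definition dual_vol :: "(real \<Rightarrow> 'a::euclidean_space \<Rightarrow> real) \<Rightarrow> 'a set \<Rightarrow> real" where
  "dual_vol G K = (\<integral>u. G (radial_fun K u) u \<partial>spherical_measure)"

definition hom_dual_vol :: "(real \<Rightarrow> 'a::euclidean_space \<Rightarrow> real) \<Rightarrow> 'a set \<Rightarrow> real" where
  "hom_dual_vol G K =
     Inf {\<eta>. \<eta> > 0 \<and> (\<integral>u. G (radial_fun K u / \<eta>) u \<partial>spherical_measure) \<le> 1}"

definition B_tilde :: "(real \<Rightarrow> 'a::euclidean_space \<Rightarrow> real) \<Rightarrow> 'a set set" where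
  "B_tilde G = {Q \<in> bodies_o. dual_vol G (polar_body Q) = dual_vol G (cball 0 1)}"

definition B_hat :: "(real \<Rightarrow> 'a::euclidean_space \<Rightarrow> real) \<Rightarrow> 'a set set" where
  "B_hat G = {Q \<in> bodies_o. hom_dual_vol G (polar_body Q) = hom_dual_vol G (cball 0 1)}"

definition finite_sphere_measure :: "'a::euclidean_space measure \<Rightarrow> bool" where
  "finite_sphere_measure \<mu> \<longleftrightarrow>
     finite_measure \<mu> \<and> sets \<mu> = sets (restrict_space borel (sphere 0 1))"

definition not_conc_hemisphere :: "'a::euclidean_space measure \<Rightarrow> bool" where
  "not_conc_hemisphere \<mu> \<longleftrightarrow>
     (\<forall>v\<in>sphere 0 1. measure \<mu> {u \<in> sphere 0 1. u \<bullet> v > 0} > 0)"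

definition sphere_weak_conv ::
    "(nat \<Rightarrow> 'a::euclidean_space measure) \<Rightarrow> 'a measure \<Rightarrow> bool" where
  "sphere_weak_conv \<mu>s \<mu> \<longleftrightarrow>
     (\<forall>f :: 'a \<Rightarrow> real. continuous_on (sphere 0 1) f \<longrightarrow>
        (\<lambda>i. \<integral>u. f u \<partial>\<mu>s i) \<longlonglongrightarrow> (\<integral>u. f u \<partial>\<mu>))"

definition orlicz_functional ::
    "(real \<Rightarrow> real) \<Rightarrow> 'a::euclidean_space measure \<Rightarrow> 'a set \<Rightarrow> real" where
  "orlicz_functional \<phi> \<mu> Q = (\<integral>u. \<phi> (support_fun Q u) \<partial>\<mu>)"

end

theory Submission
  imports Defs "HOL-Complex_Analysis.Great_Picard"
begin

text \<open>
  Since \<open>\<rho>\<close> of the polar body is \<open>1 / h\<close>, membership of \<open>Q\<close> in \<open>B_tilde G\<close> fixes the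
  integral of \<open>G (1 / h\<^sub>Q)\<close>. Comparison with the unit ball bounds the functionals of the
  minimisers, and as \<open>\<mu>\<close> is not concentrated on a hemisphere, this bounds the minimisers
  themselves, so a subsequence of their support functions converges uniformly to the support
  function \<open>h\<close> of a compact convex set. If \<open>h\<close> vanished at a point \<open>v\<close> of the sphere, then
  \<open>h u \<le> R |u - v|\<close>, and the growth \<open>G t u \<ge> c t\<^sup>n\<^sup>-\<^sup>1\<close> would contradict Fatou's lemma, because
  \<open>|u - v|\<^sup>1\<^sup>-\<^sup>n\<close> is not integrable on the sphere. So the limit is again a body in \<open>B_tilde G\<close>,
  and it is optimal by weak convergence. The homogeneous case is the same statement for a
  rescaled \<open>G\<close>: if \<open>\<eta>\<close> is the homogeneous dual volume of the ball, then
  \<open>B_hat G = B_tilde (\<lambda>t u. G (t / \<eta>) u)\<close>.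
\<close>

section \<open>The Hausdorff measure\<close>

text \<open>The exponent n - 1 is the borderline case. On the cap of radius 1/k about a zero of the
  limit \<open>h\<close> the integrand is of order k^(n-1), while the cap has measure at least of
  order k^(1-n); so every cap contributes a fixed positive amount, although the integrals of an
  integrable function over shrinking caps tend to 0. Hence the long preparation: the spherical
  measure is given only through coverings, and three facts have to be extracted from that
  definition, namely agreement with the outer measure on Borel sets, finiteness on the sphere, and
  the lower bound for caps. The last one compares a covering of the cap with a covering of the cone
  over it, whose size Lebesgue measure knows.

  Compactness yields limits of subsequences only, and different subsequences may lead to different
  bodies. All these bodies minimise the same functional, so the limiting value is the same for each,
  and this is what gives convergence of the whole sequence of values.\<close>

definition hausdorff_weight :: "nat \<Rightarrow> 'a::euclidean_space set \<Rightarrow> ennreal" where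
  "hausdorff_weight m U =
     (if U = {} then 0 else ennreal (unit_ball_vol (real m) * (diameter U / 2) ^ m))"

definition hausdorff_covers :: "real \<Rightarrow> 'a::euclidean_space set \<Rightarrow> (nat \<Rightarrow> 'a set) set" where
  "hausdorff_covers \<delta> A = {U. A \<subseteq> (\<Union>j. U j) \<and> (\<forall>j. bounded (U j) \<and> diameter (U j) \<le> \<delta>)}"

lemma hausdorff_content_altdef:
  "hausdorff_content m \<delta> A = (INF U \<in> hausdorff_covers \<delta> A. \<Sum>j. hausdorff_weight m (U j))"
  unfolding hausdorff_content_def hausdorff_covers_def hausdorff_weight_def ..

lemma hausdorff_weight_empty [simp]: "hausdorff_weight m {} = 0"
  by (simp add: hausdorff_weight_def)

lemma hausdorff_content_le:
  "U \<in> hausdorff_covers \<delta> A \<Longrightarrow> hausdorff_content m \<delta> A \<le> (\<Sum>j. hausdorff_weight m (U j))"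
  unfolding hausdorff_content_altdef by (rule INF_lower)

lemma hausdorff_content_mono: "A \<subseteq> B \<Longrightarrow> hausdorff_content m \<delta> A \<le> hausdorff_content m \<delta> B"
  unfolding hausdorff_content_altdef
  by (rule INF_superset_mono) (auto simp: hausdorff_covers_def)

lemma hausdorff_content_antimono:
  "\<delta> \<le> \<delta>' \<Longrightarrow> hausdorff_content m \<delta>' A \<le> hausdorff_content m \<delta> A"
  unfolding hausdorff_content_altdef
  by (rule INF_superset_mono) (auto simp: hausdorff_covers_def intro: order_trans)

lemma hausdorff_content_empty:
  assumes "\<delta> \<ge> 0"
  shows "hausdorff_content m \<delta> {} = 0"
  using hausdorff_content_le[of "\<lambda>_. {}" \<delta> "{}" m] assms by (simp add: hausdorff_covers_def)

text \<open>Covers of the \<open>A n\<close> that are optimal up to \<open>e * (1/2)^Suc n\<close>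
  are merged into a single sequence by \<open>prod_decode\<close>; the errors add up to
  \<open>e\<close>, and the diameter bound is inherited.\<close>

lemma hausdorff_content_UN_le:
  "hausdorff_content m \<delta> (\<Union>i. A i) \<le> (\<Sum>i::nat. hausdorff_content m \<delta> (A i))"
proof (rule ennreal_le_epsilon)
  fix e :: real assume e: "e > 0" and "(\<Sum>i. hausdorff_content m \<delta> (A i)) < top"
  then have "hausdorff_content m \<delta> (A n) < hausdorff_content m \<delta> (A n) + e * (1/2)^Suc n" for n
    by (auto simp add: less_top dest!: ennreal_suminf_lessD)
  then have "\<exists>U\<in>hausdorff_covers \<delta> (A n). (\<Sum>j. hausdorff_weight m (U j)) <
      hausdorff_content m \<delta> (A n) + e * (1/2)^Suc n" for n
    unfolding hausdorff_content_altdef INF_less_iff by auto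
  then obtain B where B: "\<And>n. B n \<in> hausdorff_covers \<delta> (A n)"
    and less: "\<And>n. (\<Sum>j. hausdorff_weight m (B n j)) < hausdorff_content m \<delta> (A n) + e * (1/2)^Suc n"
    by metis
  define C where "C = case_prod B \<circ> prod_decode"
  have "(\<Union>i. A i) \<subseteq> (\<Union>k. C k)"
  proof
    fix x assume "x \<in> (\<Union>i. A i)"
    then obtain i j where "x \<in> B i j"
      using B by (fastforce simp: hausdorff_covers_def)
    then have "x \<in> C (prod_encode (i, j))" by (simp add: C_def)
    then show "x \<in> (\<Union>k. C k)" by blast
  qed
  then have "C \<in> hausdorff_covers \<delta> (\<Union>i. A i)"
    using B by (auto simp: hausdorff_covers_def C_def split: prod.splits)
  then have "hausdorff_content m \<delta> (\<Union>i. A i) \<le> (\<Sum>k. hausdorff_weight m (C k))"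
    by (rule hausdorff_content_le)
  also have "\<dots> = (\<Sum>k. (case_prod (\<lambda>i j. hausdorff_weight m (B i j))) (prod_decode k))"
    by (simp add: C_def split_def)
  also have "\<dots> = (\<Sum>n. \<Sum>j. hausdorff_weight m (B n j))"
    using suminf_ennreal_2dimen[of _ "case_prod (\<lambda>i j. hausdorff_weight m (B i j))"]
    by (simp add: comp_def)
  also have "\<dots> \<le> (\<Sum>n. hausdorff_content m \<delta> (A n) + e * (1/2)^Suc n)"
    by (intro suminf_le less_imp_le[OF less]) auto
  also have "\<dots> = (\<Sum>n. hausdorff_content m \<delta> (A n)) + (\<Sum>n. ennreal e * ennreal ((1/2) ^ Suc n))"
    using e by (subst suminf_add[symmetric])
       (auto simp del: ennreal_suminf_cmult simp add: ennreal_mult[symmetric])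
  also have "\<dots> = (\<Sum>n. hausdorff_content m \<delta> (A n)) + e"
    unfolding ennreal_suminf_cmult
    by (subst suminf_ennreal_eq[OF zero_le_power power_half_series]) auto
  finally show "hausdorff_content m \<delta> (\<Union>i. A i) \<le> (\<Sum>i. hausdorff_content m \<delta> (A i)) + e" .
qed

lemma hausdorff_content_le_outer:
  "\<delta> > 0 \<Longrightarrow> hausdorff_content m \<delta> A \<le> hausdorff_outer m A"
  unfolding hausdorff_outer_def by (rule SUP_upper) auto

lemma hausdorff_outer_mono: "A \<subseteq> B \<Longrightarrow> hausdorff_outer m A \<le> hausdorff_outer m B"
  unfolding hausdorff_outer_def by (intro SUP_mono) (auto intro: hausdorff_content_mono)

lemma hausdorff_outer_empty [simp]: "hausdorff_outer m {} = 0"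
  unfolding hausdorff_outer_def by (auto simp: hausdorff_content_empty)

lemma hausdorff_outer_UN_le:
  "hausdorff_outer m (\<Union>i. A i) \<le> (\<Sum>i::nat. hausdorff_outer m (A i))"
  unfolding hausdorff_outer_def[of m "\<Union>i. A i"]
proof (rule SUP_least)
  fix \<delta> :: real assume "\<delta> \<in> {0<..}"
  then show "hausdorff_content m \<delta> (\<Union>i. A i) \<le> (\<Sum>i. hausdorff_outer m (A i))"
    by (intro order_trans[OF hausdorff_content_UN_le] suminf_le hausdorff_content_le_outer) auto
qed

lemma hausdorff_outer_measure_space: "outer_measure_space UNIV (hausdorff_outer m)"
  unfolding outer_measure_space_def positive_def increasing_def countably_subadditive_def
  by (auto intro: hausdorff_outer_mono hausdorff_outer_UN_le)

lemma hausdorff_outer_Un_le: "hausdorff_outer m (A \<union> B) \<le> hausdorff_outer m A + hausdorff_outer m B"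
  using hausdorff_outer_UN_le[of m "binaryset A B"]
  by (simp add: UN_binaryset_eq suminf_binaryset_eq)

text \<open>
  A cover by sets of diameter less than the distance of \<open>A\<close> and \<open>B\<close> splits into a cover of \<open>A\<close>
  and a cover of \<open>B\<close>.
\<close>
lemma hausdorff_outer_separated:
  assumes d: "d > 0" and AB: "\<And>x y. x \<in> A \<Longrightarrow> y \<in> B \<Longrightarrow> d \<le> dist x y"
  shows "hausdorff_outer m A + hausdorff_outer m B \<le> hausdorff_outer m (A \<union> B)"
proof -
  have content: "hausdorff_content m \<delta> A + hausdorff_content m \<delta> B \<le> hausdorff_content m \<delta> (A \<union> B)"
    if \<delta>: "0 < \<delta>" "\<delta> < d" for \<delta>
    unfolding hausdorff_content_altdef[of m \<delta> "A \<union> B"]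
  proof (rule INF_greatest)
    fix U assume U: "U \<in> hausdorff_covers \<delta> (A \<union> B)"
    define V where "V X j = (if U j \<inter> X = {} then {} else U j)" for X j
    have V: "V X \<in> hausdorff_covers \<delta> X" if "X \<subseteq> A \<union> B" for X
      unfolding hausdorff_covers_def
    proof (intro CollectI conjI subsetI allI)
      fix x assume "x \<in> X"
      then have "x \<in> A \<union> B" using that by blast
      moreover have "A \<union> B \<subseteq> (\<Union>j. U j)" using U unfolding hausdorff_covers_def by blast
      ultimately have "x \<in> (\<Union>j. U j)" by blast
      then obtain j where "x \<in> U j" by blast
      with \<open>x \<in> X\<close> have "x \<in> V X j" by (auto simp: V_def)
      then show "x \<in> (\<Union>j. V X j)" by blast
    qed (use U \<delta> in \<open>auto simp: V_def hausdorff_covers_def\<close>)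
    have "hausdorff_weight m (V A j) + hausdorff_weight m (V B j) \<le> hausdorff_weight m (U j)" for j
    proof (cases "U j \<inter> A = {} \<or> U j \<inter> B = {}")
      case False
      then obtain x y where "x \<in> U j" "x \<in> A" "y \<in> U j" "y \<in> B" by blast
      then have "d \<le> diameter (U j)"
        using AB diameter_bounded_bound[of "U j" x y] U by (force simp: hausdorff_covers_def)
      then show ?thesis using U \<delta> by (force simp: hausdorff_covers_def dest: spec[of _ j])
    qed (auto simp: V_def)
    then have "(\<Sum>j. hausdorff_weight m (V A j)) + (\<Sum>j. hausdorff_weight m (V B j)) \<le>
        (\<Sum>j. hausdorff_weight m (U j))"
      by (subst suminf_add) (auto intro!: suminf_le)
    then show "hausdorff_content m \<delta> A + hausdorff_content m \<delta> B \<le> (\<Sum>j. hausdorff_weight m (U j))"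
      by (intro order_trans[OF add_mono[OF hausdorff_content_le[OF V] hausdorff_content_le[OF V]]]) auto
  qed
  \<comment> \<open>The two outer measures are suprema over independent scales. Both contents only
    grow when the scales are replaced by a common smaller one, which can also be taken below
    \<open>d\<close>.\<close>
  have "hausdorff_content m \<delta> A + hausdorff_content m \<delta>' B \<le> hausdorff_outer m (A \<union> B)"
    if "\<delta> > 0" "\<delta>' > 0" for \<delta> \<delta>'
  proof -
    define \<eta> where "\<eta> = min (d/2) (min \<delta> \<delta>')"
    have \<eta>: "0 < \<eta>" "\<eta> < d" "\<eta> \<le> \<delta>" "\<eta> \<le> \<delta>'" using that d by (auto simp: \<eta>_def)
    have "hausdorff_content m \<delta> A + hausdorff_content m \<delta>' B
        \<le> hausdorff_content m \<eta> A + hausdorff_content m \<eta> B"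
      by (intro add_mono hausdorff_content_antimono \<eta>)
    also have "\<dots> \<le> hausdorff_content m \<eta> (A \<union> B)" by (intro content \<eta>)
    also have "\<dots> \<le> hausdorff_outer m (A \<union> B)" by (intro hausdorff_content_le_outer \<eta>)
    finally show ?thesis .
  qed
  note le = this
  have ne: "{0::real<..} \<noteq> {}" by (metis greaterThan_iff empty_iff zero_less_one)
  have "hausdorff_outer m A + hausdorff_outer m B =
      (SUP \<delta>\<in>{0<..}. hausdorff_content m \<delta> A + hausdorff_outer m B)"
    unfolding hausdorff_outer_def[of m A] by (rule ennreal_SUP_add_left[OF ne, symmetric])
  also have "\<dots> = (SUP \<delta>\<in>{0<..}. SUP \<delta>'\<in>{0<..}. hausdorff_content m \<delta> A + hausdorff_content m \<delta>' B)"
    unfolding hausdorff_outer_def[of m B] by (simp add: ennreal_SUP_add_right[OF ne])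
  also have "\<dots> \<le> hausdorff_outer m (A \<union> B)"
    using le by (intro SUP_least) auto
  finally show ?thesis .
qed

section \<open>Caratheodory measurability of Borel sets\<close>

lemma ennreal_suminf_tail_LIMSEQ:
  fixes f :: "nat \<Rightarrow> ennreal"
  assumes "(\<Sum>i. f i) < top"
  shows "(\<lambda>k. \<Sum>i. f (i + k)) \<longlonglongrightarrow> 0"
proof -
  have fin: "f i < top" for i using assms ennreal_suminf_lessD[of f] by simp
  define g where "g i = enn2real (f i)" for i
  have g: "f i = ennreal (g i)" "g i \<ge> 0" for i
    using fin[of i] by (auto simp: g_def)
  have sg: "summable g"
    using assms g by (intro summable_suminf_not_top) auto
  have "(\<Sum>i. f (i + k)) = ennreal (\<Sum>i. g (i + k))" for k
    unfolding g(1) using g(2) sg by (intro suminf_ennreal2) (auto simp: summable_iff_shift)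
  moreover have "(\<lambda>k. \<Sum>i. g (i + k)) \<longlonglongrightarrow> 0"
  proof -
    have "(\<lambda>k. suminf g - sum g {..<k}) \<longlonglongrightarrow> suminf g - suminf g"
      by (intro tendsto_intros summable_LIMSEQ sg)
    then show ?thesis using sg by (simp add: suminf_minus_initial_segment)
  qed
  ultimately show ?thesis using tendsto_ennrealI by fastforce
qed

text \<open>Caratheodory's argument for metric outer measures. The part \<open>A k\<close> of
  \<open>E\<close> at distance at least 1/(k+1) from \<open>F\<close> is separated from
  \<open>F \<inter> E\<close>, so additivity holds for these two. What \<open>A k\<close> misses of
  \<open>E - F\<close> lies in the shells \<open>D (i + k)\<close>. Shells with indices of equal
  parity are separated from each other, hence the measures of all shells have sum at most twice that
  of \<open>E\<close>, and the tail of this series vanishes.\<close>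

lemma closed_in_lambda_system_hausdorff:
  assumes F: "closed (F :: 'a::euclidean_space set)"
  shows "F \<in> lambda_system UNIV UNIV (hausdorff_outer m)"
proof -
  let ?H = "hausdorff_outer m"
  have le: "?H (F \<inter> E) + ?H (E - F) \<le> ?H E" if fin: "?H E < top" and ne: "F \<noteq> {}" for E
  proof -
    define A where "A k = {x\<in>E. inverse (real (Suc k)) \<le> infdist x F}" for k
    define D where "D k = {x\<in>E. inverse (real (Suc (Suc k))) \<le> infdist x F \<and>
                              infdist x F < inverse (real (Suc k))}" for k
    have lip: "\<bar>infdist x F - infdist y F\<bar> \<le> dist x y" for x y
      using infdist_triangle_abs[of x F y] by simp
    \<comment> \<open>Between shell \<open>2*n+c\<close> and the earlier ones of the same parity
      lies shell \<open>2*n+c-1\<close>, and its width is the gap \<open>?d\<close>. For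
      \<open>n = 0\<close> the union is empty.\<close>
    have sep: "?H (\<Union>j<n. D (2*j+c)) + ?H (D (2*n+c)) \<le> ?H ((\<Union>j<n. D (2*j+c)) \<union> D (2*n+c))" for n c
    proof (cases "n = 0")
      case False
      let ?d = "inverse (real (2*n+c)) - inverse (real (Suc (2*n+c)))"
      show ?thesis
      proof (rule hausdorff_outer_separated[of ?d])
        show "?d > 0" using False by (simp add: less_imp_inverse_less)
        fix x y assume "x \<in> (\<Union>j<n. D (2*j+c))" and y: "y \<in> D (2*n+c)"
        then obtain j where j: "j < n" "x \<in> D (2*j+c)" by auto
        then have "inverse (real (2*n+c)) \<le> inverse (real (Suc (Suc (2*j+c))))"
          by (intro le_imp_inverse_le) auto
        also have "\<dots> \<le> infdist x F" using j by (simp add: D_def del: of_nat_Suc)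
        finally have "inverse (real (2*n+c)) \<le> infdist x F" .
        moreover have "infdist y F < inverse (real (Suc (2*n+c)))" using y by (auto simp: D_def)
        ultimately show "?d \<le> dist x y" using lip[of x y] by linarith
      qed
    qed auto
    have sumD: "(\<Sum>j<n. ?H (D (2*j+c))) \<le> ?H (\<Union>j<n. D (2*j+c))" for n c
    proof (induction n)
      case (Suc n)
      have "(\<Sum>j<Suc n. ?H (D (2*j+c))) \<le> ?H (\<Union>j<n. D (2*j+c)) + ?H (D (2*n+c))"
        using Suc by (simp add: add_right_mono)
      also note sep
      also have "(\<Union>j<n. D (2*j+c)) \<union> D (2*n+c) = (\<Union>j<Suc n. D (2*j+c))"
        by (auto simp: lessThan_Suc)
      finally show ?case .
    qed auto
    have half: "(\<Sum>j<n. ?H (D (2*j+c))) \<le> ?H E" for n c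
      by (rule order_trans[OF sumD]) (auto simp: D_def intro: hausdorff_outer_mono)
    have "(\<Sum>j<n. ?H (D j)) \<le> ?H E + ?H E" for n
    proof -
      have "(\<Sum>j<n. ?H (D j)) \<le> (\<Sum>j<2*n. ?H (D j))" by (intro sum_mono2) auto
      also have "\<dots> = (\<Sum>j<n. ?H (D (2*j+0))) + (\<Sum>j<n. ?H (D (2*j+1)))"
        by (induction n) (auto simp: algebra_simps)
      also have "\<dots> \<le> ?H E + ?H E" by (intro add_mono half)
      finally show ?thesis .
    qed
    then have "(\<Sum>j. ?H (D j)) \<le> ?H E + ?H E"
      by (intro suminf_le_const) auto
    then have tail: "(\<lambda>k. \<Sum>i. ?H (D (i + k))) \<longlonglongrightarrow> 0"
      using fin by (intro ennreal_suminf_tail_LIMSEQ)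
        (auto intro: order_le_less_trans simp: ennreal_add_less_top)
    have main: "?H (F \<inter> E) + ?H (E - F) \<le> ?H E + (\<Sum>i. ?H (D (i + k)))" for k
    proof -
      have "E - F \<subseteq> A k \<union> (\<Union>i. D (i + k))"
      proof
        fix x assume x: "x \<in> E - F"
        then have "infdist x F > 0" using F ne by (simp add: infdist_pos_not_in_closed)
        then obtain N where N: "inverse (real (Suc N)) < infdist x F" using reals_Archimedean by blast
        show "x \<in> A k \<union> (\<Union>i. D (i + k))"
        proof (rule ccontr)
          assume nin: "\<not> ?thesis"
          \<comment> \<open>Avoiding \<open>A k\<close> and every shell pushes the distance of
            \<open>x\<close> below each bound in turn, so it would be 0, which is impossible outside
            a closed set.\<close>
          have "infdist x F < inverse (real (Suc (i + k)))" for i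
          proof (induction i)
            case 0 then show ?case using nin x by (auto simp: A_def not_le)
          next
            case (Suc i) 
            have "x \<notin> D (i + k)" using nin by blast
            then show ?case using Suc x by (auto simp: D_def not_le)
          qed
          from this[of N] have "infdist x F < inverse (real (Suc (N + k)))" .
          also have "\<dots> \<le> inverse (real (Suc N))" by (intro le_imp_inverse_le) auto
          finally show False using N by simp
        qed
      qed
      then have "?H (E - F) \<le> ?H (A k) + ?H (\<Union>i. D (i + k))"
        by (meson order_trans hausdorff_outer_mono hausdorff_outer_Un_le)
      also have "\<dots> \<le> ?H (A k) + (\<Sum>i. ?H (D (i + k)))"
        by (intro add_left_mono hausdorff_outer_UN_le)
      finally have "?H (F \<inter> E) + ?H (E - F) \<le> (?H (F \<inter> E) + ?H (A k)) + (\<Sum>i. ?H (D (i + k)))"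
        by (simp add: add.assoc add_left_mono)
      also have "?H (F \<inter> E) + ?H (A k) \<le> ?H (F \<inter> E \<union> A k)"
      proof (rule hausdorff_outer_separated[of "inverse (real (Suc k))"])
        fix x y assume "x \<in> F \<inter> E" "y \<in> A k"
        then show "inverse (real (Suc k)) \<le> dist x y"
          using lip[of y x] by (auto simp: A_def dist_commute)
      qed auto
      also have "?H (F \<inter> E \<union> A k) \<le> ?H E" by (intro hausdorff_outer_mono) (auto simp: A_def)
      finally show ?thesis by (simp add: add_right_mono)
    qed
    have "?H (F \<inter> E) + ?H (E - F) \<le> ?H E + 0"
      by (rule LIMSEQ_le_const[OF tendsto_add[OF tendsto_const tail]]) (use main in auto)
    then show ?thesis by simp
  qed
  have "?H (F \<inter> E) + ?H (E - F) = ?H E" for E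
  proof (rule antisym)
    \<comment> \<open>\<open>infdist\<close> to the empty set is 0 by convention, so
      \<open>F = {}\<close> is treated apart; the tail argument in turn requires \<open>?H E\<close>
      to be finite.\<close>
    show "?H (F \<inter> E) + ?H (E - F) \<le> ?H E"
      by (cases "F = {} \<or> ?H E = top") (use le[of E] in \<open>auto simp: less_top[symmetric]\<close>)
    show "?H E \<le> ?H (F \<inter> E) + ?H (E - F)"
      using hausdorff_outer_Un_le[of m "F \<inter> E" "E - F"] by (simp add: Int_Diff_Un Int_commute)
  qed
  then show ?thesis
    by (auto simp: lambda_system_def Diff_eq Int_commute)
qed

lemma sets_hausdorff_measure [simp, measurable_cong]: "sets (hausdorff_measure m) = sets borel"
  unfolding hausdorff_measure_def by (metis sets.sigma_sets_eq sets_measure_of space_borel subset_UNIV top_greatest Pow_UNIV)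

lemma space_hausdorff_measure [simp]: "space (hausdorff_measure m) = UNIV"
  using sets_eq_imp_space_eq[OF sets_hausdorff_measure, of m] by simp

text \<open>\<open>measure_of\<close> returns the zero measure unless its argument is countably
  additive. Caratheodory's lemma supplies this on the lambda system, which is a sigma-algebra
  containing the closed sets and hence all Borel sets.\<close>

lemma emeasure_hausdorff_measure:
  assumes "A \<in> sets borel"
  shows "emeasure (hausdorff_measure m) A = hausdorff_outer m A"
proof -
  interpret P: sigma_algebra UNIV "UNIV :: 'a set set"
    using sigma_algebra_Pow[of UNIV] by simp
  let ?L = "lambda_system UNIV UNIV (hausdorff_outer m :: 'a set \<Rightarrow> _)"
  have ms: "measure_space UNIV ?L (hausdorff_outer m)"
    by (rule P.caratheodory_lemma[OF hausdorff_outer_measure_space])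
  then interpret L: sigma_algebra UNIV ?L by (simp add: measure_space_def)
  have sub: "sets borel \<subseteq> ?L"
    unfolding borel_eq_closed
    using L.sigma_sets_subset[of "Collect closed"] closed_in_lambda_system_hausdorff by auto
  show ?thesis
    unfolding hausdorff_measure_def
  proof (rule emeasure_measure_of_sigma)
    show "sigma_algebra UNIV (sets (borel :: 'a measure))"
      using sets.sigma_algebra_axioms[of borel] by simp
    show "positive (sets borel) (hausdorff_outer m)" by (simp add: positive_def)
    show "countably_additive (sets (borel :: 'a measure)) (hausdorff_outer m)"
      using ms sub by (auto simp: measure_space_def countably_additive_def)
  qed fact
qed

section \<open>Spherical caps\<close>

lemma hausdorff_content_finite_cover:
  assumes P: "finite P" and A: "A \<subseteq> (\<Union>p\<in>P. cball p r)" and r: "0 \<le> r" "2 * r \<le> \<delta>"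
  shows "hausdorff_content m \<delta> A \<le> of_nat (card P) * ennreal (unit_ball_vol (real m) * r ^ m)"
proof -
  obtain f :: "nat \<Rightarrow> _" where f: "bij_betw f {..<card P} P"
    using ex_bij_betw_nat_finite[OF P] by (auto simp: lessThan_atLeast0)
  define U where "U j = (if j < card P then cball (f j) r else {})" for j
  have "A \<subseteq> (\<Union>j. U j)"
  proof
    fix x assume "x \<in> A"
    then obtain p where p: "p \<in> P" "x \<in> cball p r" using A by blast
    then obtain j where "j < card P" "f j = p" using f unfolding bij_betw_def by (metis imageE lessThan_iff)
    then have "x \<in> U j" using p by (simp add: U_def)
    then show "x \<in> (\<Union>j. U j)" by blast
  qed
  then have "U \<in> hausdorff_covers \<delta> A"
    using r by (auto simp: U_def hausdorff_covers_def)
  then have "hausdorff_content m \<delta> A \<le> (\<Sum>j. hausdorff_weight m (U j))"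
    by (rule hausdorff_content_le)
  also have "\<dots> = (\<Sum>j<card P. hausdorff_weight m (U j))"
    by (rule suminf_finite) (auto simp: U_def)
  also have "\<dots> \<le> (\<Sum>j<card P. ennreal (unit_ball_vol (real m) * r ^ m))"
    using r by (intro sum_mono) (auto simp: U_def hausdorff_weight_def)
  finally show ?thesis by simp
qed

text \<open>Up to the volume of the unit ball, the left side is the volume of the shell between the
  radii 1 - s and 1 + s; what matters is that it is linear in the thickness.\<close>

lemma power_shell_le:
  fixes s :: real
  assumes "0 \<le> s" "s \<le> 1"
  shows "(1 + s) ^ n - (1 - s) ^ n \<le> real n * 2 ^ n * s"
proof (induction n)
  case (Suc n)
  have d0: "(1 + s) ^ n - (1 - s) ^ n \<ge> 0" using assms by (simp add: power_mono)
  have p1: "(1 - s) ^ n \<le> 1" using assms by (intro power_le_one) auto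
  have "(1 + s) ^ Suc n - (1 - s) ^ Suc n =
      (1 + s) * ((1 + s) ^ n - (1 - s) ^ n) + 2 * s * (1 - s) ^ n"
    by (simp add: algebra_simps)
  also have "\<dots> \<le> 2 * (real n * 2 ^ n * s) + 2 * s * 1"
    using assms Suc d0 p1 by (intro add_mono mult_mono) auto
  also have "\<dots> \<le> real (Suc n) * 2 ^ Suc n * s"
  proof -
    have "s * 1 \<le> s * 2 ^ n" using assms by (intro mult_left_mono) auto
    then show ?thesis by (simp add: algebra_simps)
  qed
  finally show ?case .
qed simp

text \<open>The balls of half the radius about separated points are disjoint and fill part of a thin shell.\<close>
lemma card_separated_sphere_le:
  fixes P :: "'a::euclidean_space set"
  assumes P: "finite P" "P \<subseteq> sphere 0 1" and r: "0 < r" "r \<le> 1"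
    and sep: "\<And>p q. p \<in> P \<Longrightarrow> q \<in> P \<Longrightarrow> p \<noteq> q \<Longrightarrow> r \<le> dist p q"
  shows "real (card P) * r ^ (DIM('a) - 1) \<le> real DIM('a) * 4 ^ DIM('a)"
proof -
  define n where "n = DIM('a)"
  define m where "m = n - 1"
  have n: "n = Suc m" by (simp add: n_def m_def)
  define w where "w = unit_ball_vol (real n)"
  have w: "w > 0" by (simp add: w_def)
  have "real (card P) * (w * (r/2) ^ n) = (\<Sum>p\<in>P. measure lborel (ball p (r/2)))"
    using r by (simp add: content_ball w_def n_def)
  also have "\<dots> = measure lborel (\<Union>p\<in>P. ball p (r/2))"
  proof (rule measure_finite_Union[symmetric])
    show "disjoint_family_on (\<lambda>p. ball p (r/2)) P"
      unfolding disjoint_family_on_def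
    proof safe
      fix p q x assume "p \<in> P" "q \<in> P" "p \<noteq> q" "x \<in> ball p (r/2)" "x \<in> ball q (r/2)"
      then show "x \<in> {}" using sep[of p q] dist_triangle[of p q x] by (auto simp: dist_commute)
    qed
  qed (use P in \<open>auto simp: emeasure_ball[OF less_imp_le] r\<close>)
  also have "\<dots> \<le> measure lborel (cball (0::'a) (1 + r/2) - ball 0 (1 - r/2))"
  proof (rule measure_mono_fmeasurable)
    show "(\<Union>p\<in>P. ball p (r/2)) \<subseteq> cball 0 (1 + r/2) - ball 0 (1 - r/2)"
    proof
      fix x assume "x \<in> (\<Union>p\<in>P. ball p (r/2))"
      then obtain p where "norm p = 1" "norm (p - x) < r/2" using P by (auto simp: dist_norm)
      then show "x \<in> cball 0 (1 + r/2) - ball 0 (1 - r/2)"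
        using norm_triangle_ineq2[of p x] norm_triangle_ineq2[of x p] by (auto simp: norm_minus_commute)
    qed
  next
    show "(\<Union>p\<in>P. ball p (r/2)) \<in> sets lborel" using P(1) by auto
    have "cball (0::'a) (1 + r/2) \<in> fmeasurable lborel"
      using r by (simp add: fmeasurable_def emeasure_cball)
    then show "cball (0::'a) (1 + r/2) - ball 0 (1 - r/2) \<in> fmeasurable lborel"
      by (rule fmeasurable_Diff) simp
  qed
  also have "\<dots> = measure lborel (cball (0::'a) (1 + r/2)) - measure lborel (ball (0::'a) (1 - r/2))"
    using r by (intro measure_Diff) (auto simp: emeasure_cball)
  also have "\<dots> = w * ((1 + r/2) ^ n - (1 - r/2) ^ n)"
    using r by (simp add: content_ball content_cball w_def n_def algebra_simps)
  also have "\<dots> \<le> w * (real n * 2 ^ n * (r/2))"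
    using w r by (intro mult_left_mono power_shell_le) auto
  \<comment> \<open>One factor \<open>r/2\<close> of the ball volumes cancels against the thickness
    of the shell. This lowers the exponent from \<open>n\<close> to \<open>m\<close>.\<close>
  finally have "w * ((r/2) * (real (card P) * (r/2) ^ m)) \<le> w * ((r/2) * (real n * 2 ^ n))"
    by (simp add: n mult_ac)
  then have "real (card P) * (r/2) ^ m \<le> real n * 2 ^ n"
    using w r by simp
  moreover have "(2::real) ^ m \<le> 2 ^ n" using n by simp
  ultimately have "2 ^ m * (real (card P) * (r/2) ^ m) \<le> 2 ^ n * (real n * 2 ^ n)"
    using r by (intro mult_mono[of "2 ^ m" "2 ^ n"]) auto
  also have "2 ^ m * (real (card P) * (r/2) ^ m) = real (card P) * r ^ m"
    by (simp add: power_divide)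
  also have "2 ^ n * (real n * 2 ^ n) = real n * 4 ^ n"
    by (simp add: power_mult_distrib[symmetric])
  finally show ?thesis by (simp add: n_def m_def)
qed

text \<open>A maximal \<open>r\<close>-separated subset of the sphere is also an
  \<open>r\<close>-net. Separation limits its cardinality to order \<open>r ^ -m\<close>, so the
  balls of radius \<open>r\<close> about it form a cover whose total weight is bounded independently
  of the scale.\<close>

lemma hausdorff_outer_sphere_finite:
  "hausdorff_outer (DIM('a) - 1) (sphere (0::'a::euclidean_space) 1) < top"
proof -
  define m where "m = DIM('a) - 1"
  define C where "C = real DIM('a) * 4 ^ DIM('a)"
  have "hausdorff_content m \<delta> (sphere (0::'a) 1) \<le> ennreal (C * unit_ball_vol (real m))"
    if \<delta>: "\<delta> > 0" for \<delta>
  proof -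
    \<comment> \<open>The packing bound needs \<open>r \<le> 1\<close>, and balls of radius at most
      \<open>\<delta>/2\<close> are admissible at scale \<open>\<delta>\<close>.\<close>
    define r where "r = min 1 (\<delta>/2)"
    have r: "0 < r" "r \<le> 1" "2 * r \<le> \<delta>" using \<delta> by (auto simp: r_def)
    define good where "good P \<longleftrightarrow> finite P \<and> P \<subseteq> sphere (0::'a) 1 \<and>
        (\<forall>p\<in>P. \<forall>q\<in>P. p \<noteq> q \<longrightarrow> r \<le> dist p q)" for P
    have card_le: "real (card P) * r ^ m \<le> C" if "good P" for P
      using card_separated_sphere_le[of P r] that r by (auto simp: good_def m_def C_def)
    have "card P < Suc (nat \<lfloor>C / r ^ m\<rfloor>)" if "good P" for P
    proof -
      have "real (card P) \<le> C / r ^ m" using card_le[OF that] r by (simp add: field_simps)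
      then have "card P \<le> nat \<lfloor>C / r ^ m\<rfloor>" by (simp add: le_nat_floor)
      then show ?thesis by simp
    qed
    moreover have "good {}" by (simp add: good_def)
    ultimately obtain P where P: "good P" "\<And>Q. good Q \<Longrightarrow> card Q \<le> card P"
      using ex_has_greatest_nat[of good "{}" card] by blast
    have "sphere (0::'a) 1 \<subseteq> (\<Union>p\<in>P. cball p r)"
    proof (rule ccontr)
      assume "\<not> ?thesis"
      then obtain x where "x \<in> sphere 0 1" "x \<notin> (\<Union>p\<in>P. cball p r)" by blast
      then have x: "x \<in> sphere 0 1" "\<And>p. p \<in> P \<Longrightarrow> r < dist p x" by (auto simp: not_le)
      then have "good (insert x P)" using P(1) r
        by (auto simp: good_def dist_commute less_imp_le)
      moreover have "x \<notin> P" using x(2)[of x] r by auto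
      moreover have "finite P" using P(1) by (simp add: good_def)
      ultimately show False using P(2)[of "insert x P"] by simp
    qed
    then have "hausdorff_content m \<delta> (sphere (0::'a) 1)
        \<le> of_nat (card P) * ennreal (unit_ball_vol (real m) * r ^ m)"
      using P(1) r by (intro hausdorff_content_finite_cover) (auto simp: good_def)
    also have "\<dots> = ennreal (real (card P) * (unit_ball_vol (real m) * r ^ m))"
      using r by (simp add: ennreal_mult ennreal_of_nat_eq_real_of_nat)
    also have "\<dots> = ennreal ((real (card P) * r ^ m) * unit_ball_vol (real m))"
      by (simp add: mult_ac)
    also have "\<dots> \<le> ennreal (C * unit_ball_vol (real m))"
      using card_le[OF P(1)] by (intro ennreal_leI mult_right_mono) auto
    finally show ?thesis .
  qed
  then have "hausdorff_outer m (sphere (0::'a) 1) \<le> ennreal (C * unit_ball_vol (real m))"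
    unfolding hausdorff_outer_def by (intro SUP_least) auto
  then show ?thesis unfolding m_def by (simp add: order_le_less_trans)
qed

text \<open>
  The part of the cone over \<open>U\<close> inside the unit ball lies in a tube of radius \<open>2 d\<close> about a segment
  of length \<open>1\<close>, where \<open>d\<close> is the diameter of \<open>U\<close>.
\<close>
lemma cone_subset_tube:
  fixes x :: "'a::euclidean_space"
  assumes d: "0 < d" "d \<le> 1" and x: "norm x = 1"
  obtains W where "W \<in> sets borel"
    "emeasure lborel W \<le> ennreal (2 * 2 ^ DIM('a) * unit_ball_vol DIM('a) * d ^ (DIM('a) - 1))"
    "\<And>y. norm y \<le> 1 \<Longrightarrow> dist x (y /\<^sub>R norm y) \<le> d \<Longrightarrow> y \<in> W"
proof
  define n where "n = DIM('a)"
  define m where "m = n - 1"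
  have n: "n = Suc m" by (simp add: n_def m_def)
  \<comment> \<open>Centres at spacing \<open>d\<close> along the unit segment: there are
    \<open>K + 1\<close> of them, at most \<open>2 / d\<close> because
    \<open>d \<le> 1\<close>.\<close>
  define K where "K = nat \<lfloor>1 / d\<rfloor>"
  define W where "W = (\<Union>k\<le>K. cball ((real k * d) *\<^sub>R x) (2 * d))"
  show "W \<in> sets borel" unfolding W_def by (intro sets.countable_UN'') auto
  have K: "real K \<le> 1 / d" using d by (simp add: K_def)
  have "emeasure lborel W \<le> (\<Sum>k\<le>K. emeasure lborel (cball ((real k * d) *\<^sub>R x) (2 * d)))"
    unfolding W_def by (intro emeasure_subadditive_finite) auto
  also have "\<dots> = ennreal (real (Suc K) * (unit_ball_vol n * (2 * d) ^ n))"
    using d by (simp add: emeasure_cball n_def ennreal_mult ennreal_of_nat_eq_real_of_nat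
        flip: of_nat_Suc)
  also have "\<dots> \<le> ennreal (2 / d * (unit_ball_vol n * (2 * d) ^ n))"
  proof (intro ennreal_leI mult_right_mono)
    show "real (Suc K) \<le> 2 / d" using K d by (simp add: field_simps)
  qed (use d in auto)
  also have "2 / d * (unit_ball_vol n * (2 * d) ^ n) = 2 * 2 ^ n * unit_ball_vol n * d ^ m"
    using d by (simp add: n power_mult_distrib)
  finally show "emeasure lborel W \<le> ennreal (2 * 2 ^ DIM('a) * unit_ball_vol DIM('a) * d ^ (DIM('a) - 1))"
    unfolding n_def[symmetric] m_def[symmetric] by (simp add: ennreal_leI)
  fix y :: 'a assume y: "norm y \<le> 1" "dist x (y /\<^sub>R norm y) \<le> d"
  define k where "k = nat \<lfloor>norm y / d\<rfloor>"
  have "norm y / d \<le> 1 / d" using y d by (simp add: divide_right_mono)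
  then have "k \<le> K" unfolding k_def K_def by (intro nat_mono floor_mono)
  moreover have "y \<in> cball ((real k * d) *\<^sub>R x) (2 * d)"
  proof -
    have "real k = of_int \<lfloor>norm y / d\<rfloor>" using d by (simp add: k_def)
    then have "real k \<le> norm y / d" "norm y / d < real k + 1" by linarith+
    then have k: "real k * d \<le> norm y" "norm y < real k * d + d" using d by (simp_all add: field_simps)
    have "y = norm y *\<^sub>R (y /\<^sub>R norm y)" by (cases "y = 0") auto
    \<comment> \<open>The first summand is the error of rounding \<open>norm y\<close> down to a
      multiple of \<open>d\<close>, the second the deviation of \<open>y\<close> from the direction
      \<open>x\<close>; each has norm at most \<open>d\<close>.\<close>
    then have "(real k * d) *\<^sub>R x - y = (real k * d - norm y) *\<^sub>R x + norm y *\<^sub>R (x - y /\<^sub>R norm y)"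
      by (simp add: algebra_simps)
    then have "norm ((real k * d) *\<^sub>R x - y) \<le> \<bar>real k * d - norm y\<bar> * norm x + norm y * norm (x - y /\<^sub>R norm y)"
      by (metis norm_triangle_ineq norm_scaleR abs_norm_cancel)
    also have "\<dots> \<le> d * 1 + 1 * d"
      using k y x d by (intro add_mono mult_mono) (auto simp: dist_norm)
    finally show ?thesis by (simp add: dist_norm)
  qed
  ultimately show "y \<in> W" by (auto simp: W_def)
qed

text \<open>For a covering set of diameter \<open>d\<close>, both its weight and the volume of a
  tube containing the cone over it are of order \<open>d ^ m\<close>. A cover of \<open>A\<close>
  therefore produces a Borel cover of \<open>B\<close> of comparable total volume.\<close>

lemma hausdorff_outer_ge_cone:
  fixes A B :: "'a::euclidean_space set"
  assumes dim: "DIM('a) \<ge> 2" and B: "B \<in> sets borel"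
    and cone: "\<And>y. y \<in> B \<Longrightarrow> norm y \<le> 1 \<and> y /\<^sub>R norm y \<in> A" and A: "A \<subseteq> sphere 0 1"
  shows "ennreal (unit_ball_vol (real (DIM('a) - 1)) / (2 * 4 ^ DIM('a) * unit_ball_vol DIM('a))) * emeasure lborel B
         \<le> hausdorff_outer (DIM('a) - 1) A"
proof -
  define n where "n = DIM('a)"
  define m where "m = n - 1"
  have n: "n = Suc m" "m > 0" using dim by (auto simp: n_def m_def)
  \<comment> \<open>The quotient of the weight \<open>unit_ball_vol m * (d / 2) ^ m\<close> by the
    bound for the tube volume, with \<open>2 ^ m\<close> enlarged to \<open>2 ^ n\<close>.\<close>
  define c where "c = unit_ball_vol (real m) / (2 * 4 ^ n * unit_ball_vol n)"
  have c: "c > 0" by (simp add: c_def)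
  have "ennreal c * emeasure lborel B \<le> (\<Sum>j. hausdorff_weight m (U j))"
    if U: "U \<in> hausdorff_covers 1 A" for U
  proof -
    have "\<exists>W. W \<in> sets borel \<and> ennreal c * emeasure lborel W \<le> hausdorff_weight m (U j) \<and>
        (\<forall>y. norm y \<le> 1 \<and> y /\<^sub>R norm y \<in> U j \<inter> sphere 0 1 \<longrightarrow> y \<in> W)" for j
    proof (cases "U j \<inter> sphere 0 1 = {}")
      case True
      then show ?thesis by (intro exI[of _ "{}"]) auto
    next
      case False
      then obtain x where x: "x \<in> U j" "norm x = 1" by auto
      define d where "d = diameter (U j)"
      have Uj: "bounded (U j)" "d \<le> 1" using U by (auto simp: hausdorff_covers_def d_def)
      have dist: "dist x u \<le> d" if "u \<in> U j" for u
        using diameter_bounded_bound[OF Uj(1) x(1) that] by (simp add: d_def)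
      have d0: "d \<ge> 0" using diameter_ge_0[OF Uj(1)] by (simp add: d_def)
      have weight: "hausdorff_weight m (U j) = ennreal (unit_ball_vol (real m) * (d / 2) ^ m)"
        using x by (auto simp: hausdorff_weight_def d_def)
      show ?thesis
      proof (cases "d = 0")
        \<comment> \<open>Here \<open>U j\<close> is the single point \<open>x\<close> and has
          weight 0, so the covering set must be null: the line through \<open>x\<close> is, because
          the dimension is at least 2.\<close>
        case True
        have "dim (span {x}) \<le> 1" using dim_le_card[of "span {x}" "{x}"] by simp
        then have "negligible (span {x})" using dim by (intro negligible_lowdim) auto
        then have "emeasure lborel (span {x}) = 0"
          using closed_span[of "{x}"] by (simp add: negligible_iff_null_sets null_sets_completion_iff null_setsD1 borel_closed)
        moreover have "y \<in> span {x}" if "y /\<^sub>R norm y \<in> U j \<inter> sphere 0 1" for y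
        proof -
          have "y /\<^sub>R norm y = x" using dist[of "y /\<^sub>R norm y"] that True by auto
          then have "norm y *\<^sub>R x = y" by (cases "y = 0") auto
          then show ?thesis by (metis span_base span_scale insertI1)
        qed
        ultimately show ?thesis using closed_span[of "{x}"]
          by (intro exI[of _ "span {x}"]) (auto intro: borel_closed)
      next
        case False
        obtain W where W: "W \<in> sets borel"
            "emeasure lborel W \<le> ennreal (2 * 2 ^ n * unit_ball_vol n * d ^ m)"
            "\<And>y. norm y \<le> 1 \<Longrightarrow> dist x (y /\<^sub>R norm y) \<le> d \<Longrightarrow> y \<in> W"
          using cone_subset_tube[of d x] False d0 Uj(2) x(2) unfolding n_def m_def by (metis less_eq_real_def)
        have "ennreal c * emeasure lborel W \<le> ennreal c * ennreal (2 * 2 ^ n * unit_ball_vol n * d ^ m)"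
          by (intro mult_left_mono W) auto
        also have "\<dots> = ennreal (c * (2 * 2 ^ n * unit_ball_vol n * d ^ m))"
          using c d0 by (simp add: ennreal_mult)
        also have "\<dots> \<le> hausdorff_weight m (U j)"
          unfolding weight
        proof (rule ennreal_leI)
          have "c * (2 * 2 ^ n * unit_ball_vol n * d ^ m) = unit_ball_vol m * (d ^ m * (2 ^ n / 4 ^ n))"
            unfolding c_def using unit_ball_vol_pos[of "real n"] by (simp add: field_simps del: unit_ball_vol_pos)
          also have "(2::real) ^ n / 4 ^ n = 1 / 2 ^ n"
            by (simp add: power_divide[symmetric] power_one_over)
          also have "d ^ m * (1 / 2 ^ n) \<le> d ^ m * (1 / 2 ^ m)"
            using d0 n by (intro mult_left_mono divide_left_mono) auto
          finally show "c * (2 * 2 ^ n * unit_ball_vol n * d ^ m) \<le> unit_ball_vol m * (d / 2) ^ m"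
            by (simp add: power_divide)
        qed
        finally show ?thesis using W dist by blast
      qed
    qed
    then obtain W where W: "\<And>j. W j \<in> sets borel"
        "\<And>j. ennreal c * emeasure lborel (W j) \<le> hausdorff_weight m (U j)"
        "\<And>j y. norm y \<le> 1 \<and> y /\<^sub>R norm y \<in> U j \<inter> sphere 0 1 \<Longrightarrow> y \<in> W j"
      by metis
    have "B \<subseteq> (\<Union>j. W j)"
    proof
      fix y assume "y \<in> B"
      then have y: "norm y \<le> 1" "y /\<^sub>R norm y \<in> A" using cone by auto
      moreover have "A \<subseteq> (\<Union>j. U j)" using U by (simp add: hausdorff_covers_def)
      ultimately obtain j where "y /\<^sub>R norm y \<in> U j" by blast
      then show "y \<in> (\<Union>j. W j)" using W(3)[of y j] y A by blast
    qed
    then have "emeasure lborel B \<le> emeasure lborel (\<Union>j. W j)"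
      using W by (intro emeasure_mono) auto
    also have "\<dots> \<le> (\<Sum>j. emeasure lborel (W j))"
      using W by (intro emeasure_subadditive_countably) auto
    finally have "ennreal c * emeasure lborel B \<le> ennreal c * (\<Sum>j. emeasure lborel (W j))"
      by (intro mult_left_mono) auto
    also have "\<dots> = (\<Sum>j. ennreal c * emeasure lborel (W j))" by simp
    also have "\<dots> \<le> (\<Sum>j. hausdorff_weight m (U j))"
      by (intro suminf_le W) auto
    finally show ?thesis .
  qed
  then have "ennreal c * emeasure lborel B \<le> hausdorff_content m 1 A"
    unfolding hausdorff_content_altdef by (intro INF_greatest) auto
  also have "\<dots> \<le> hausdorff_outer m A" by (rule hausdorff_content_le_outer) simp
  finally show ?thesis by (simp add: c_def m_def n_def)
qed

text \<open>The cone over the cap contains \<open>N\<close> disjoint balls of radius 1/(4N) strung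
  along the ray through \<open>v\<close>. Their volume is of order N * N^(-n) = N^(1-n), and
  \<open>hausdorff_outer_ge_cone\<close> transfers this to the cap.\<close>

lemma hausdorff_outer_cap_ge:
  assumes dim: "DIM('a::euclidean_space) \<ge> 2"
  obtains c where "c > 0"
    "\<And>(v::'a) N. norm v = 1 \<Longrightarrow> N \<ge> 1 \<Longrightarrow>
       ennreal (c * (1 / real N) ^ (DIM('a) - 1))
         \<le> hausdorff_outer (DIM('a) - 1) (sphere 0 1 \<inter> cball v (1 / real N))"
proof -
  define n where "n = DIM('a)"
  define m where "m = n - 1"
  have n: "n = Suc m" using dim by (auto simp: n_def m_def)
  define b where "b = unit_ball_vol (real m) / (2 * 4 ^ n * unit_ball_vol n)"
  have b: "b > 0" by (simp add: b_def)
  define c where "c = b * (unit_ball_vol n / 4 ^ n)"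
  show ?thesis
  proof (rule that[of c])
    show "c > 0" using b by (simp add: c_def)
    fix v :: 'a and N :: nat assume v: "norm v = 1" and N: "N \<ge> 1"
    \<comment> \<open>With this radius the \<open>N\<close> balls exactly fill the segment from v/2
      to v. A point \<open>y\<close> of such a ball is within \<open>2 * \<rho>\<close> of
      \<open>norm y *\<^sub>R v\<close>; dividing by \<open>norm y \<ge> 1/2\<close> at most doubles
      this, giving 1/N.\<close>
    define \<rho> where "\<rho> = 1 / (4 * real N)"
    have \<rho>: "\<rho> > 0" "4 * \<rho> * real N = 1" "4 * \<rho> = 1 / real N" using N by (auto simp: \<rho>_def)
    define s where "s k = 1/2 + (2 * real k + 1) * \<rho>" for k
    define B where "B = (\<Union>k<N. ball (s k *\<^sub>R v) \<rho>)"
    have s: "1/2 + \<rho> \<le> s k" "s k + \<rho> \<le> 1" if "k < N" for k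
    proof -
      have "(2 * real k + 2) * \<rho> \<le> (2 * real N) * \<rho>"
        using \<rho> that by (intro mult_right_mono) auto
      then show "s k + \<rho> \<le> 1" using \<rho> by (simp add: s_def algebra_simps)
    qed (use \<rho> in \<open>auto simp: s_def algebra_simps\<close>)
    have Bm: "B \<in> sets borel" unfolding B_def by auto
    have cone: "norm y \<le> 1 \<and> y /\<^sub>R norm y \<in> sphere 0 1 \<inter> cball v (1 / real N)" if yB: "y \<in> B" for y
    proof -
      obtain k where k: "k < N" "norm (y - s k *\<^sub>R v) < \<rho>"
      proof -
        obtain k where "k < N" "y \<in> ball (s k *\<^sub>R v) \<rho>" using yB unfolding B_def by blast
        then show ?thesis using that by (metis mem_ball dist_norm norm_minus_commute)
      qed
      have sk0: "s k \<ge> 0" using s(1)[OF k(1)] \<rho> by simp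
      have sk: "norm (s k *\<^sub>R v) = s k" using v sk0 by simp
      have le: "\<bar>norm y - s k\<bar> < \<rho>" using norm_triangle_ineq3[of y "s k *\<^sub>R v"] k sk by simp
      then have y: "norm y \<le> 1" "1/2 \<le> norm y" using s[OF k(1)] by linarith+
      have "norm (norm y *\<^sub>R v - y) = norm ((norm y - s k) *\<^sub>R v - (y - s k *\<^sub>R v))"
        by (simp add: algebra_simps)
      also have "\<dots> \<le> \<bar>norm y - s k\<bar> * norm v + norm (y - s k *\<^sub>R v)"
        by (metis norm_triangle_ineq4 norm_scaleR)
      also have "\<dots> \<le> 2 * \<rho>" using v le k by simp
      finally have *: "norm (norm y *\<^sub>R v - y) \<le> 2 * \<rho>" .
      have "v - y /\<^sub>R norm y = (norm y *\<^sub>R v - y) /\<^sub>R norm y"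
        using y by (cases "y = 0") (auto simp: scaleR_diff_right)
      then have "norm (v - y /\<^sub>R norm y) = norm (norm y *\<^sub>R v - y) / norm y"
        by (simp add: divide_inverse_commute)
      also have "\<dots> \<le> 2 * \<rho> / (1/2)" using * y \<rho> by (intro frac_le) auto
      finally have "norm (v - y /\<^sub>R norm y) \<le> 1 / real N" using \<rho> by simp
      moreover have "y \<noteq> 0" using y by auto
      ultimately show ?thesis using y by (simp add: dist_norm)
    qed
    have disj: "disjoint_family_on (\<lambda>k. ball (s k *\<^sub>R v) \<rho>) {..<N}"
      unfolding disjoint_family_on_def
    proof safe
      fix j k x assume jk: "j \<noteq> k" "x \<in> ball (s j *\<^sub>R v) \<rho>" "x \<in> ball (s k *\<^sub>R v) \<rho>"
      have "dist (s j *\<^sub>R v) (s k *\<^sub>R v) = \<bar>s j - s k\<bar>"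
        using v by (simp add: dist_norm flip: scaleR_diff_left)
      also have "s j - s k = 2 * \<rho> * (real j - real k)" by (simp add: s_def algebra_simps)
      also have "\<bar>\<dots>\<bar> = 2 * \<rho> * \<bar>real j - real k\<bar>" using \<rho> by (simp add: abs_mult)
      also have "\<dots> \<ge> 2 * \<rho> * 1" using jk \<rho> by (intro mult_left_mono) auto
      finally show "x \<in> {}" using jk dist_triangle[of "s j *\<^sub>R v" "s k *\<^sub>R v" x] by (auto simp: dist_commute)
    qed
    have "emeasure lborel B = (\<Sum>k<N. emeasure lborel (ball (s k *\<^sub>R v) \<rho>))"
      unfolding B_def using disj by (intro sum_emeasure[symmetric]) auto
    also have "\<dots> = ennreal (real N * (unit_ball_vol n * \<rho> ^ n))"
      using \<rho> by (simp add: emeasure_ball n_def ennreal_mult ennreal_of_nat_eq_real_of_nat)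
    also have "real N * (unit_ball_vol n * \<rho> ^ n) = unit_ball_vol n / 4 ^ n * (1 / real N) ^ m"
      using N by (simp add: \<rho>_def n power_divide power_mult_distrib field_simps)
    finally have "ennreal b * emeasure lborel B = ennreal (c * (1 / real N) ^ m)"
      using b by (simp add: c_def ennreal_mult[symmetric] mult_ac)
    moreover have "ennreal b * emeasure lborel B \<le> hausdorff_outer m (sphere 0 1 \<inter> cball v (1 / real N))"
      unfolding b_def m_def n_def by (intro hausdorff_outer_ge_cone dim Bm cone) auto
    ultimately show "ennreal (c * (1 / real N) ^ (DIM('a) - 1))
         \<le> hausdorff_outer (DIM('a) - 1) (sphere 0 1 \<inter> cball v (1 / real N))"
      by (simp add: m_def n_def)
  qed
qed

section \<open>Transfer to the spherical measure\<close>

lemma sets_spherical_measure [measurable_cong]: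
  "sets spherical_measure = sets (restrict_space borel (sphere (0::'a::euclidean_space) 1))"
  unfolding spherical_measure_def by (intro sets_restrict_space_cong) simp

lemma space_spherical_measure [simp]: "space spherical_measure = sphere (0::'a::euclidean_space) 1"
  unfolding spherical_measure_def by (simp add: space_restrict_space)

lemma emeasure_spherical_measure:
  fixes A :: "'a::euclidean_space set"
  assumes "A \<in> sets borel" "A \<subseteq> sphere 0 1"
  shows "emeasure spherical_measure A = hausdorff_outer (DIM('a) - 1) A"
  unfolding spherical_measure_def using assms
  by (subst emeasure_restrict_space) (auto intro: emeasure_hausdorff_measure)

lemma finite_measure_spherical: "finite_measure (spherical_measure :: 'a::euclidean_space measure)"
  using hausdorff_outer_sphere_finite[where 'a='a]
  by (intro finite_measureI) (simp add: emeasure_spherical_measure borel_closed)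

lemma spherical_measure_cap_ge:
  assumes "DIM('a::euclidean_space) \<ge> 2"
  obtains c where "c > 0"
    "\<And>(v::'a) N. norm v = 1 \<Longrightarrow> N \<ge> 1 \<Longrightarrow>
       ennreal (c * (1 / real N) ^ (DIM('a) - 1))
         \<le> emeasure spherical_measure (sphere 0 1 \<inter> cball v (1 / real N))"
  using hausdorff_outer_cap_ge[OF assms]
  by (metis emeasure_spherical_measure Int_lower1 closed_Int closed_sphere closed_cball borel_closed)

section \<open>Support functions\<close>

lemma support_fun_props:
  assumes "compact K" "K \<noteq> {}"
  shows support_fun_upper: "x \<in> K \<Longrightarrow> x \<bullet> u \<le> support_fun K u"
    and support_fun_attained: "\<exists>x\<in>K. x \<bullet> u = support_fun K u"
proof -
  have "continuous_on K (\<lambda>x. x \<bullet> u)" by (intro continuous_intros)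
  from continuous_attains_sup[OF assms this]
  obtain z where z: "z \<in> K" "\<And>y. y \<in> K \<Longrightarrow> y \<bullet> u \<le> z \<bullet> u" by blast
  then have "support_fun K u = z \<bullet> u"
    unfolding support_fun_def by (intro cSup_eq_maximum) auto
  then show "x \<in> K \<Longrightarrow> x \<bullet> u \<le> support_fun K u" "\<exists>x\<in>K. x \<bullet> u = support_fun K u"
    using z by auto
qed

lemma support_fun_le:
  "K \<noteq> {} \<Longrightarrow> (\<And>x. x \<in> K \<Longrightarrow> x \<bullet> u \<le> c) \<Longrightarrow> support_fun K u \<le> c"
  unfolding support_fun_def by (intro cSUP_least)

lemma support_fun_lipschitz:
  assumes K: "compact K" "K \<noteq> {}" and R: "\<And>x. x \<in> K \<Longrightarrow> norm x \<le> R"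
  shows "\<bar>support_fun K u - support_fun K v\<bar> \<le> R * norm (u - v)"
proof -
  have *: "support_fun K u \<le> support_fun K v + R * norm (u - v)" for u v
  proof (rule support_fun_le[OF K(2)])
    fix x assume x: "x \<in> K"
    have "x \<bullet> u = x \<bullet> v + x \<bullet> (u - v)" by (simp add: inner_diff_right)
    also have "\<dots> \<le> support_fun K v + norm x * norm (u - v)"
      by (intro add_mono support_fun_upper K x norm_cauchy_schwarz)
    also have "\<dots> \<le> support_fun K v + R * norm (u - v)"
      by (intro add_left_mono mult_right_mono R x) auto
    finally show "x \<bullet> u \<le> support_fun K v + R * norm (u - v)" .
  qed
  from *[of u v] *[of v u] show ?thesis by (simp add: norm_minus_commute abs_le_iff)
qed

lemma bodies_oD:
  assumes "K \<in> bodies_o"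
  shows "compact K" "convex K" "0 \<in> interior K" "0 \<in> K" "K \<noteq> {}"
  using assms interior_subset[of K] by (auto simp: bodies_o_def)

lemma support_fun_pos:
  assumes "K \<in> bodies_o" "u \<noteq> 0"
  shows "support_fun K u > 0"
proof -
  obtain e where e: "e > 0" "cball 0 e \<subseteq> K"
    using bodies_oD(3)[OF assms(1)] mem_interior_cball by blast
  have "(e / norm u) *\<^sub>R u \<in> K" using e assms by auto
  then have "((e / norm u) *\<^sub>R u) \<bullet> u \<le> support_fun K u"
    using support_fun_upper[OF bodies_oD(1,5)[OF assms(1)]] by blast
  moreover have "((e / norm u) *\<^sub>R u) \<bullet> u > 0" using e assms by auto
  ultimately show ?thesis by linarith
qed

lemma support_fun_pos_sphere: "K \<in> bodies_o \<Longrightarrow> u \<in> sphere 0 1 \<Longrightarrow> support_fun K u > 0"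
  by (rule support_fun_pos) auto

lemma continuous_on_support_fun:
  assumes "compact K" "K \<noteq> {}"
  shows "continuous_on S (support_fun K)"
proof -
  obtain R where R: "\<And>x. x \<in> K \<Longrightarrow> norm x \<le> R" "R > 0"
    using compact_imp_bounded[OF assms(1)] bounded_pos by metis
  have "R-lipschitz_on S (support_fun K)"
    using support_fun_lipschitz[OF assms R(1)] R(2)
    by (intro lipschitz_onI) (auto simp: dist_norm)
  then show ?thesis by (rule lipschitz_on_continuous_on)
qed

lemma support_fun_bounds:
  assumes K: "(K :: 'a::euclidean_space set) \<in> bodies_o"
  obtains a b where "0 < a" "\<And>u. u \<in> sphere 0 1 \<Longrightarrow> a \<le> support_fun K u \<and> support_fun K u \<le> b"
proof -
  have c: "continuous_on (sphere 0 1) (support_fun K)"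
    using continuous_on_support_fun bodies_oD[OF K] by blast
  have ne: "sphere (0::'a) 1 \<noteq> {}" by simp
  obtain x where x: "x \<in> sphere 0 1" "\<And>u. u \<in> sphere 0 1 \<Longrightarrow> support_fun K x \<le> support_fun K u"
    using continuous_attains_inf[OF compact_sphere ne c] by blast
  obtain y where y: "\<And>u. u \<in> sphere 0 1 \<Longrightarrow> support_fun K u \<le> support_fun K y"
    using continuous_attains_sup[OF compact_sphere ne c] by blast
  have "x \<noteq> 0" using x by auto
  then show ?thesis using x y support_fun_pos[OF K, of x] by (intro that[of "support_fun K x"]) auto
qed

lemma support_fun_cball: "norm u = 1 \<Longrightarrow> support_fun (cball 0 1) u = 1"
  unfolding support_fun_def
proof (rule cSup_eq_maximum)
  assume u: "norm u = 1"
  have "u \<bullet> u = 1" using u by (simp add: dot_square_norm)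
  then show "1 \<in> (\<lambda>x. x \<bullet> u) ` cball 0 1"
    using u by (intro image_eqI[of _ _ u]) auto
  show "y \<le> 1" if y: "y \<in> (\<lambda>x. x \<bullet> u) ` cball 0 1" for y
  proof -
    obtain x where "norm x \<le> 1" "y = x \<bullet> u" using y by auto
    then show ?thesis using norm_cauchy_schwarz[of x u] u by simp
  qed
qed

lemma cball_in_bodies_o: "cball 0 1 \<in> bodies_o"
  by (auto simp: bodies_o_def)

lemma radial_fun_cball: "norm u = 1 \<Longrightarrow> radial_fun (cball 0 1) u = 1"
  unfolding radial_fun_def by (rule cSup_eq_maximum) auto

text \<open>Among all constraints on a multiple \<open>l *\<^sub>R u\<close> with
  \<open>l \<ge> 0\<close>, the sharpest comes from a point of \<open>K\<close> where the inner
  product with \<open>u\<close> is maximal. So the admissible \<open>l\<close> form the interval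
  from 0 to the reciprocal of the support function.\<close>

lemma radial_fun_polar_body:
  assumes K: "K \<in> bodies_o" and u: "u \<noteq> 0"
  shows "radial_fun (polar_body K) u = 1 / support_fun K u"
proof -
  note K' = bodies_oD[OF K]
  have pos: "support_fun K u > 0" using support_fun_pos[OF K u] .
  have "(l *\<^sub>R u \<in> polar_body K) \<longleftrightarrow> l * support_fun K u \<le> 1" if "l \<ge> 0" for l
  proof
    assume l: "l *\<^sub>R u \<in> polar_body K"
    obtain x where "x \<in> K" "x \<bullet> u = support_fun K u"
      using support_fun_attained[OF K'(1,5), of u] by blast
    then show "l * support_fun K u \<le> 1" using l by (auto simp: polar_body_def inner_commute)
  next
    assume l: "l * support_fun K u \<le> 1"
    have "l * (x \<bullet> u) \<le> 1" if "x \<in> K" for x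
      using mult_left_mono[OF support_fun_upper[OF K'(1) K'(5) that, of u] \<open>l \<ge> 0\<close>] l by linarith
    then show "l *\<^sub>R u \<in> polar_body K" by (auto simp: polar_body_def inner_commute)
  qed
  then have "{l. 0 \<le> l \<and> l *\<^sub>R u \<in> polar_body K} = {0..1 / support_fun K u}"
    using pos by (auto simp: field_simps)
  then show ?thesis using pos by (simp add: radial_fun_def)
qed

text \<open>
  A form of Blaschke's selection theorem. The limit body is described by its supporting half-spaces,
  and maximisers of linear functionals over the \<open>M i\<close> accumulate in it.
\<close>
lemma blaschke_selection:
  fixes M :: "nat \<Rightarrow> 'a::euclidean_space set"
  assumes M: "\<And>i. compact (M i)" "\<And>i. M i \<noteq> {}" and R: "\<And>i x. x \<in> M i \<Longrightarrow> norm x \<le> R"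
  obtains K r where "compact K" "convex K" "K \<noteq> {}" "\<And>x. x \<in> K \<Longrightarrow> norm x \<le> R"
    "strict_mono (r :: nat \<Rightarrow> nat)"
    "uniform_limit (sphere 0 1) (\<lambda>i. support_fun (M (r i))) (support_fun K) sequentially"
    "K = {x. \<forall>v\<in>sphere 0 1. x \<bullet> v \<le> support_fun K v}"
proof -
  obtain x0 where "x0 \<in> M 0" using M(2)[of 0] by blast
  then have R0: "R \<ge> 0" using R[of x0 0] norm_ge_zero[of x0] by linarith
  have bd: "\<bar>support_fun (M i) u\<bar> \<le> R" if "u \<in> sphere 0 1" for i u
  proof -
    obtain x where x: "x \<in> M i" "x \<bullet> u = support_fun (M i) u"
      using support_fun_attained[OF M, of i u] by blast
    have "\<bar>x \<bullet> u\<bar> \<le> norm x * norm u" by (rule Cauchy_Schwarz_ineq2)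
    also have "\<dots> \<le> R" using R[OF x(1)] that by simp
    finally show ?thesis using x by simp
  qed
  \<comment> \<open>Arzela-Ascoli: all the support functions share the Lipschitz constant
    \<open>R\<close>. The modulus \<open>e / (R + 1)\<close> also covers
    \<open>R = 0\<close>.\<close>
  obtain g and r :: "nat \<Rightarrow> nat" where g: "continuous_on (sphere 0 1) g" and r: "strict_mono r"
    and conv: "\<And>e. 0 < e \<Longrightarrow> \<exists>N. \<forall>n x. n \<ge> N \<and> x \<in> sphere 0 1 \<longrightarrow>
        norm (support_fun (M (r n)) x - g x) < e"
  proof (rule Arzela_Ascoli[of "sphere (0::'a) 1" "\<lambda>i. support_fun (M i)" R])
    fix x :: 'a and e :: real assume "x \<in> sphere 0 1" "0 < e"
    have "\<forall>n y. y \<in> sphere 0 1 \<and> norm (x - y) < e / (R + 1) \<longrightarrow>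
        norm (support_fun (M n) x - support_fun (M n) y) < e"
    proof safe
      fix n y assume "norm (x - y) < e / (R + 1)"
      then have "(R + 1) * norm (x - y) < e" using R0 by (simp add: field_simps)
      moreover have "R * norm (x - y) \<le> (R + 1) * norm (x - y)" by (intro mult_right_mono) auto
      ultimately show "norm (support_fun (M n) x - support_fun (M n) y) < e"
        using support_fun_lipschitz[OF M(1)[of n] M(2)[of n] R[of _ n], of x y] by (simp add: real_norm_def)
    qed
    then show "\<exists>d. 0 < d \<and> (\<forall>n y. y \<in> sphere 0 1 \<and> norm (x - y) < d \<longrightarrow>
        norm (support_fun (M n) x - support_fun (M n) y) < e)"
      using \<open>0 < e\<close> R0 by (intro exI[of _ "e / (R + 1)"]) auto
  qed (use bd in auto)
  have ul: "uniform_limit (sphere 0 1) (\<lambda>i. support_fun (M (r i))) g sequentially"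
    unfolding uniform_limit_sequentially_iff
    using conv by (auto simp: dist_norm) (metis mem_sphere_0)
  have lim: "(\<lambda>i. support_fun (M (r i)) u) \<longlonglongrightarrow> g u" if "u \<in> sphere 0 1" for u
    using tendsto_uniform_limitI[OF ul that] .
  define K where "K = {x. \<forall>v\<in>sphere 0 1. x \<bullet> v \<le> g v}"
  \<comment> \<open>For an arbitrary \<open>g\<close>, the intersection \<open>K\<close> of
    half-spaces could have a smaller support function or be empty. Limits of maximisers rule out
    both.\<close>
  have attain: "\<exists>x\<in>K. x \<bullet> u = g u" if u: "u \<in> sphere 0 1" for u
  proof -
    have "\<forall>i. \<exists>x\<in>M (r i). x \<bullet> u = support_fun (M (r i)) u"
      using support_fun_attained[OF M] by blast
    then obtain x where x: "\<And>i. x i \<in> M (r i)" "\<And>i. x i \<bullet> u = support_fun (M (r i)) u" by metis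
    have "\<forall>i. x i \<in> cball 0 R" using x R by auto
    then obtain z and s :: "nat \<Rightarrow> nat" where s: "strict_mono s" "(x \<circ> s) \<longlonglongrightarrow> z"
      using compact_cball[of "0::'a" R] unfolding compact_def by metis
    have limv: "(\<lambda>i. support_fun (M (r (s i))) v) \<longlonglongrightarrow> g v" if "v \<in> sphere 0 1" for v
      using LIMSEQ_subseq_LIMSEQ[OF lim[OF that] s(1)] by (simp add: o_def)
    have xv: "(\<lambda>i. x (s i) \<bullet> v) \<longlonglongrightarrow> z \<bullet> v" for v
      using tendsto_inner[OF s(2) tendsto_const[of v]] by (simp add: o_def)
    have "z \<bullet> v \<le> g v" if "v \<in> sphere 0 1" for v
      using LIMSEQ_le[OF xv limv[OF that]] support_fun_upper[OF M x(1)] by auto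
    moreover have "z \<bullet> u = g u"
      using LIMSEQ_unique[OF xv[of u]] limv[OF u] x(2) by simp
    ultimately show ?thesis unfolding K_def by blast
  qed
  have ne: "K \<noteq> {}" using attain[of "SOME i. i \<in> Basis"] by (auto simp: SOME_Basis)
  have KR: "norm x \<le> R" if "x \<in> K" for x
  proof (cases "x = 0")
    case False
    have s: "x /\<^sub>R norm x \<in> sphere 0 1" using False by simp
    have "x \<bullet> (x /\<^sub>R norm x) \<le> g (x /\<^sub>R norm x)" using that s unfolding K_def by blast
    also have "\<dots> \<le> R"
      using LIMSEQ_le_const2[OF lim[OF s]] bd[OF s] by (meson abs_le_D1)
    also have "x \<bullet> (x /\<^sub>R norm x) = norm x"
      using False by (simp add: dot_square_norm power2_eq_square)
    finally show ?thesis .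
  qed (use R0 in auto)
  have eq: "K = (\<Inter>v\<in>sphere 0 1. {x. v \<bullet> x \<le> g v})" by (auto simp: K_def inner_commute)
  have "closed K" unfolding eq by (intro closed_INT ballI closed_halfspace_le)
  moreover have "bounded K" using KR by (auto simp: bounded_iff)
  ultimately have comp: "compact K" by (simp add: compact_eq_bounded_closed)
  have conv: "convex K" unfolding eq by (intro convex_INT convex_halfspace_le)
  have sup: "support_fun K u = g u" if u: "u \<in> sphere 0 1" for u
  proof (rule antisym)
    show "support_fun K u \<le> g u" using u by (intro support_fun_le ne) (auto simp: K_def)
    show "g u \<le> support_fun K u" using attain[OF u] support_fun_upper[OF comp ne, of _ u] by metis
  qed
  show ?thesis
  proof (rule that[OF comp conv ne KR r])
    show "uniform_limit (sphere 0 1) (\<lambda>i. support_fun (M (r i))) (support_fun K) sequentially"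
      using ul sup by (simp add: uniform_limit_iff)
    show "K = {x. \<forall>v\<in>sphere 0 1. x \<bullet> v \<le> support_fun K v}" using sup by (auto simp: K_def)
  qed
qed

section \<open>Integrals over the sphere\<close>

lemma finite_sphere_measure_spherical: "finite_sphere_measure spherical_measure"
  by (simp add: finite_sphere_measure_def finite_measure_spherical sets_spherical_measure)

lemma space_finite_sphere_measure:
  "finite_sphere_measure \<mu> \<Longrightarrow> space \<mu> = sphere 0 1"
  unfolding finite_sphere_measure_def by (metis sets_eq_imp_space_eq space_restrict_space2 space_borel
      sets.top space_restrict_space Int_UNIV_right)

lemma borel_measurable_on_sphere:
  fixes f :: "'a::euclidean_space \<Rightarrow> real"
  assumes "finite_sphere_measure \<mu>" "continuous_on (sphere 0 1) f"
  shows "f \<in> borel_measurable \<mu>"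
proof -
  have "f \<in> borel_measurable (restrict_space borel (sphere 0 1))"
    using assms(2) by (rule borel_measurable_continuous_on_restrict)
  then show ?thesis
    using assms(1) measurable_cong_sets unfolding finite_sphere_measure_def by blast
qed

lemma continuous_on_sphere_bounded:
  fixes f :: "'a::euclidean_space \<Rightarrow> real"
  assumes "continuous_on (sphere 0 1) f"
  obtains C where "C > 0" "\<And>u. u \<in> sphere 0 1 \<Longrightarrow> \<bar>f u\<bar> \<le> C"
  using compact_imp_bounded[OF compact_continuous_image[OF assms compact_sphere]]
  unfolding bounded_pos by (metis imageI real_norm_def)

lemma integrable_on_sphere:
  fixes f :: "'a::euclidean_space \<Rightarrow> real"
  assumes \<mu>: "finite_sphere_measure \<mu>" and f: "continuous_on (sphere 0 1) f"
  shows "integrable \<mu> f"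
proof -
  interpret finite_measure \<mu> using \<mu> by (simp add: finite_sphere_measure_def)
  obtain C where "\<And>u. u \<in> sphere 0 1 \<Longrightarrow> \<bar>f u\<bar> \<le> C"
    using continuous_on_sphere_bounded[OF f] by blast
  then show ?thesis
    using space_finite_sphere_measure[OF \<mu>]
    by (intro integrable_const_bound[of _ C] borel_measurable_on_sphere assms AE_I2) auto
qed

lemma integral_mono_on_sphere:
  fixes f g :: "'a::euclidean_space \<Rightarrow> real"
  assumes "finite_sphere_measure \<mu>" "continuous_on (sphere 0 1) f" "continuous_on (sphere 0 1) g"
    and "\<And>u. u \<in> sphere 0 1 \<Longrightarrow> f u \<le> g u"
  shows "(\<integral>u. f u \<partial>\<mu>) \<le> (\<integral>u. g u \<partial>\<mu>)"
  using assms by (intro integral_mono integrable_on_sphere) (auto simp: space_finite_sphere_measure)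

lemma integral_const_on_sphere:
  assumes "finite_sphere_measure \<mu>"
  shows "(\<integral>u. c \<partial>\<mu>) = measure \<mu> (sphere 0 1) * (c::real)"
proof -
  interpret finite_measure \<mu> using assms by (simp add: finite_sphere_measure_def)
  show ?thesis using space_finite_sphere_measure[OF assms] by simp
qed

lemma sphere_weak_conv_measure:
  assumes "sphere_weak_conv \<mu>s \<mu>" "finite_sphere_measure \<mu>" "\<And>i. finite_sphere_measure (\<mu>s i)"
  shows "(\<lambda>i. measure (\<mu>s i) (sphere 0 1)) \<longlonglongrightarrow> measure \<mu> (sphere 0 1)"
proof -
  have "(\<lambda>i. \<integral>u. 1 \<partial>\<mu>s i) \<longlonglongrightarrow> (\<integral>u. (1::real) \<partial>\<mu>)"
    using assms(1) unfolding sphere_weak_conv_def by (metis continuous_on_const)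
  then show ?thesis
    unfolding integral_const_on_sphere[OF assms(2)] integral_const_on_sphere[OF assms(3)] by simp
qed

lemma sphere_weak_conv_subseq:
  assumes "sphere_weak_conv \<mu>s \<mu>" "strict_mono (r :: nat \<Rightarrow> nat)"
  shows "sphere_weak_conv (\<lambda>i. \<mu>s (r i)) \<mu>"
  unfolding sphere_weak_conv_def
proof safe
  fix f :: "'a \<Rightarrow> real" assume "continuous_on (sphere 0 1) f"
  then have "(\<lambda>i. \<integral>u. f u \<partial>\<mu>s i) \<longlonglongrightarrow> (\<integral>u. f u \<partial>\<mu>)"
    using assms(1) unfolding sphere_weak_conv_def by blast
  from LIMSEQ_subseq_LIMSEQ[OF this assms(2)]
  show "(\<lambda>i. \<integral>u. f u \<partial>\<mu>s (r i)) \<longlonglongrightarrow> (\<integral>u. f u \<partial>\<mu>)" by (simp add: o_def)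
qed

text \<open>Integrand and measure vary together. Replacing \<open>g i\<close> by \<open>f\<close>
  costs at most their uniform distance times the mass of \<open>\<mu>s i\<close>, and the masses are
  bounded because they converge; for the fixed \<open>f\<close> weak convergence applies.\<close>

lemma sphere_weak_conv_uniform_limit:
  fixes f :: "'a::euclidean_space \<Rightarrow> real"
  assumes weak: "sphere_weak_conv \<mu>s \<mu>"
    and fin: "finite_sphere_measure \<mu>" "\<And>i. finite_sphere_measure (\<mu>s i)"
    and cont: "continuous_on (sphere 0 1) f" "\<And>i. continuous_on (sphere 0 1) (g i)"
    and unif: "uniform_limit (sphere 0 1) g f sequentially"
  shows "(\<lambda>i. \<integral>u. g i u \<partial>\<mu>s i) \<longlonglongrightarrow> (\<integral>u. f u \<partial>\<mu>)"
proof -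
  let ?m = "\<lambda>i. measure (\<mu>s i) (sphere 0 1)"
  obtain C where C: "C > 0" "\<And>i. norm (?m i) \<le> C"
    using Bseq_def convergent_imp_Bseq[OF convergentI[OF sphere_weak_conv_measure[OF weak fin]]] by metis
  have "(\<lambda>i. (\<integral>u. g i u \<partial>\<mu>s i) - (\<integral>u. f u \<partial>\<mu>s i)) \<longlonglongrightarrow> 0"
  proof (rule LIMSEQ_I)
    fix e :: real assume e: "e > 0"
    define d where "d = e / (2 * C)"
    have d: "d > 0" using e C by (simp add: d_def)
    obtain N where N: "\<And>i u. i \<ge> N \<Longrightarrow> u \<in> sphere 0 1 \<Longrightarrow> dist (g i u) (f u) < d"
      using unif d unfolding uniform_limit_sequentially_iff by blast
    have "norm ((\<integral>u. g i u \<partial>\<mu>s i) - (\<integral>u. f u \<partial>\<mu>s i) - 0) < e" if i: "i \<ge> N" for i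
    proof -
      have c: "continuous_on (sphere 0 1) (\<lambda>u. g i u - f u)" by (intro continuous_intros cont)
      have "\<bar>\<integral>u. g i u - f u \<partial>\<mu>s i\<bar> \<le> (\<integral>u. \<bar>g i u - f u\<bar> \<partial>\<mu>s i)" by (rule integral_abs_bound)
      also have "\<dots> \<le> (\<integral>u. d \<partial>\<mu>s i)"
        using N[OF i] by (intro integral_mono_on_sphere fin continuous_intros cont)
          (force simp: dist_real_def less_imp_le)
      also have "\<dots> = ?m i * d" by (rule integral_const_on_sphere[OF fin(2)])
      also have "\<dots> \<le> C * d" using C(2)[of i] d by (intro mult_right_mono) auto
      also have "\<dots> < e" using C e by (simp add: d_def)
      also have "(\<integral>u. g i u - f u \<partial>\<mu>s i) = (\<integral>u. g i u \<partial>\<mu>s i) - (\<integral>u. f u \<partial>\<mu>s i)"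
        by (intro Bochner_Integration.integral_diff integrable_on_sphere fin cont)
      finally show ?thesis by simp
    qed
    then show "\<exists>N. \<forall>i\<ge>N. norm ((\<integral>u. g i u \<partial>\<mu>s i) - (\<integral>u. f u \<partial>\<mu>s i) - 0) < e" by blast
  qed
  moreover have "(\<lambda>i. \<integral>u. f u \<partial>\<mu>s i) \<longlonglongrightarrow> (\<integral>u. f u \<partial>\<mu>)"
    using weak cont unfolding sphere_weak_conv_def by blast
  ultimately have "(\<lambda>i. ((\<integral>u. g i u \<partial>\<mu>s i) - (\<integral>u. f u \<partial>\<mu>s i)) + (\<integral>u. f u \<partial>\<mu>s i)) \<longlonglongrightarrow> 0 + (\<integral>u. f u \<partial>\<mu>)"
    by (rule tendsto_add)
  then show ?thesis by simp
qed

section \<open>Integrals of functions in \<open>class_GI\<close>\<close>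

lemma class_GID:
  assumes "G \<in> class_GI"
  shows class_GI_pos: "t > 0 \<Longrightarrow> u \<in> sphere 0 1 \<Longrightarrow> G t u > 0"
    and class_GI_less: "0 < s \<Longrightarrow> s < t \<Longrightarrow> u \<in> sphere 0 1 \<Longrightarrow> G s u < G t u"
    and class_GI_le: "0 < s \<Longrightarrow> s \<le> t \<Longrightarrow> u \<in> sphere 0 1 \<Longrightarrow> G s u \<le> G t u"
    and class_GI_tendsto_0: "u \<in> sphere 0 1 \<Longrightarrow> ((\<lambda>t. G t u) \<longlongrightarrow> 0) (at_right 0)"
    and class_GI_continuous: "continuous_on ({0<..} \<times> sphere 0 1) (\<lambda>(t, u). G t u)"
proof -
  show l: "0 < s \<Longrightarrow> s < t \<Longrightarrow> u \<in> sphere 0 1 \<Longrightarrow> G s u < G t u" for s t u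
    using assms unfolding class_GI_def strict_mono_on_def by auto
  show "0 < s \<Longrightarrow> s \<le> t \<Longrightarrow> u \<in> sphere 0 1 \<Longrightarrow> G s u \<le> G t u" for s t u
    using l[of s t u] by (cases "s = t") auto
qed (use assms in \<open>auto simp: class_GI_def\<close>)

lemma class_GI_continuous_comp:
  assumes G: "G \<in> class_GI" and f: "continuous_on (sphere 0 1) f" "\<And>u. u \<in> sphere 0 1 \<Longrightarrow> f u > 0"
  shows "continuous_on (sphere 0 1) (\<lambda>u. G (f u) u)"
proof -
  have "continuous_on (sphere 0 1) (\<lambda>u. (f u, u))" by (intro continuous_intros f)
  moreover have "(\<lambda>u. (f u, u)) ` sphere 0 1 \<subseteq> {0<..} \<times> sphere 0 1" using f(2) by auto
  ultimately show ?thesis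
    using continuous_on_compose2[OF class_GI_continuous[OF G], of "sphere 0 1" "\<lambda>u. (f u, u)"] by simp
qed

text \<open>Monotonicity in the first argument gives the continuous majorant
  \<open>G (max a b)\<close>; taking the maximum makes the argument visibly positive. The lower
  bound \<open>a\<close> keeps the limit \<open>f'\<close> inside the domain where \<open>G\<close>
  is continuous.\<close>

lemma class_GI_integral_tendsto:
  assumes G: "G \<in> class_GI" and \<mu>: "finite_sphere_measure \<mu>"
    and cont: "\<And>i. continuous_on (sphere 0 1) (f i)" "continuous_on (sphere 0 1) f'"
    and bounds: "0 < a" "\<And>i u. u \<in> sphere 0 1 \<Longrightarrow> a \<le> f i u \<and> f i u \<le> b"
    and lim: "\<And>u. u \<in> sphere 0 1 \<Longrightarrow> (\<lambda>i. f i u) \<longlonglongrightarrow> f' u"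
  shows "(\<lambda>i::nat. \<integral>u. G (f i u) u \<partial>\<mu>) \<longlonglongrightarrow> (\<integral>u. G (f' u) u \<partial>\<mu>)"
proof (rule integral_dominated_convergence[where w = "\<lambda>u. G (max a b) u"])
  have f': "a \<le> f' u" if "u \<in> sphere 0 1" for u
    using bounds(2)[OF that] by (intro LIMSEQ_le_const[OF lim[OF that]]) auto
  have pos: "0 < f' u" "0 < f i u" if "u \<in> sphere 0 1" for u i
    using f'[OF that] bounds(2)[OF that, of i] bounds(1) by linarith+
  show "(\<lambda>u. G (f' u) u) \<in> borel_measurable \<mu>"
    by (intro borel_measurable_on_sphere \<mu> class_GI_continuous_comp[OF G] cont pos)
  show "(\<lambda>u. G (f i u) u) \<in> borel_measurable \<mu>" for i
    by (intro borel_measurable_on_sphere \<mu> class_GI_continuous_comp[OF G] cont pos)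
  show "integrable \<mu> (\<lambda>u. G (max a b) u)"
    using bounds by (intro integrable_on_sphere \<mu> class_GI_continuous_comp[OF G]) (auto intro: continuous_intros)
  show "AE u in \<mu>. norm (G (f i u) u) \<le> G (max a b) u" for i
  proof (rule AE_I2)
    fix u assume "u \<in> space \<mu>"
    then have u: "u \<in> sphere 0 1" by (simp add: space_finite_sphere_measure[OF \<mu>])
    have "0 < f i u" "f i u \<le> max a b" using bounds(1) bounds(2)[OF u, of i] by auto
    then show "norm (G (f i u) u) \<le> G (max a b) u"
      using class_GI_pos[OF G _ u, of "f i u"] class_GI_le[OF G _ _ u, of "f i u" "max a b"] by simp
  qed
  show "AE u in \<mu>. (\<lambda>i. G (f i u) u) \<longlonglongrightarrow> G (f' u) u"
  proof (rule AE_I2)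
    fix u assume "u \<in> space \<mu>"
    then have u: "u \<in> sphere 0 1" by (simp add: space_finite_sphere_measure[OF \<mu>])
    have "continuous_on {0<..} (\<lambda>t. (t, u))" by (intro continuous_intros)
    moreover have "(\<lambda>t. (t, u)) ` {0<..} \<subseteq> {0<..} \<times> sphere 0 1" using u by auto
    ultimately have c: "continuous_on {0<..} (\<lambda>t. G t u)"
      using continuous_on_compose2[OF class_GI_continuous[OF G], of "{0<..}" "\<lambda>t. (t, u)"] by simp
    show "(\<lambda>i. G (f i u) u) \<longlonglongrightarrow> G (f' u) u"
      using pos[OF u] by (intro continuous_on_tendsto_compose[OF c lim[OF u]]) auto
  qed
qed

text \<open>
  By Fatou's lemma \<open>F = liminf G(1/h\<^sub>i)\<close> is integrable. The Lipschitz bound on the \<open>h\<^sub>i\<close> and the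
  growth of \<open>G\<close> give \<open>F\<close> a non-integrable singularity at the zero \<open>v\<close> of the limit: the integrals
  over the caps of radius \<open>1 / k\<close> about \<open>v\<close> stay away from \<open>0\<close>.
\<close>
lemma support_fun_not_tendsto_0:
  fixes M :: "nat \<Rightarrow> 'a::euclidean_space set" and G :: "real \<Rightarrow> 'a \<Rightarrow> real"
  assumes dim: "DIM('a) \<ge> 2" and G: "G \<in> class_GI"
    and growth: "c > 0" "T > 0" "\<And>t u. t \<ge> T \<Longrightarrow> u \<in> sphere 0 1 \<Longrightarrow> c * t ^ (DIM('a) - 1) \<le> G t u"
    and M: "\<And>i. M i \<in> bodies_o" and R: "\<And>i x. x \<in> M i \<Longrightarrow> norm x \<le> R"
    and C: "\<And>i. (\<integral>u. G (1 / support_fun (M i) u) u \<partial>spherical_measure) \<le> C"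
    and v: "v \<in> sphere 0 1"
  shows "\<not> (\<lambda>i. support_fun (M i) v) \<longlonglongrightarrow> 0"
proof
  assume lim: "(\<lambda>i. support_fun (M i) v) \<longlonglongrightarrow> 0"
  let ?\<sigma> = "spherical_measure :: 'a measure"
  note fin = finite_sphere_measure_spherical[where 'a='a]
  define m where "m = DIM('a) - 1"
  define h where "h i = support_fun (M i)" for i
  define R' where "R' = \<bar>R\<bar> + 1"
  have R': "R' > 0" "\<And>i x. x \<in> M i \<Longrightarrow> norm x \<le> R'"
    using R by (force simp: R'_def)+
  have hpos: "h i u > 0" if "u \<in> sphere 0 1" for i u
    unfolding h_def by (rule support_fun_pos_sphere[OF M that])
  have hcont: "continuous_on (sphere 0 1) (h i)" for i
    unfolding h_def by (rule continuous_on_support_fun[OF bodies_oD(1,5)[OF M]])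
  have gcont: "continuous_on (sphere 0 1) (\<lambda>u. G (1 / h i u) u)" for i
    using hpos[of _ i] by (intro class_GI_continuous_comp[OF G] continuous_intros hcont) (force dest: hpos)+
  define F where "F u = liminf (\<lambda>i. ennreal (G (1 / h i u) u))" for u
  have meas: "(\<lambda>u. ennreal (G (1 / h i u) u)) \<in> borel_measurable ?\<sigma>" for i
    using borel_measurable_on_sphere[OF fin gcont] by measurable
  have Fm: "F \<in> borel_measurable ?\<sigma>"
    unfolding F_def using meas by measurable
  have "(\<integral>\<^sup>+u. ennreal (G (1 / h i u) u) \<partial>?\<sigma>) \<le> ennreal C" for i
  proof -
    have "(\<integral>\<^sup>+u. ennreal (G (1 / h i u) u) \<partial>?\<sigma>) = ennreal (\<integral>u. G (1 / h i u) u \<partial>?\<sigma>)"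
      using hpos by (intro nn_integral_eq_integral integrable_on_sphere fin gcont AE_I2)
        (auto intro!: less_imp_le class_GI_pos[OF G])
    then show ?thesis using C[of i] by (simp add: h_def ennreal_leI)
  qed
  then have "liminf (\<lambda>i. \<integral>\<^sup>+u. ennreal (G (1 / h i u) u) \<partial>?\<sigma>) \<le> ennreal C"
    by (intro order_trans[OF Liminf_le_Limsup] Limsup_bounded) auto
  then have "(\<integral>\<^sup>+u. F u \<partial>?\<sigma>) \<le> ennreal C"
    unfolding F_def using nn_integral_liminf[OF meas] by (rule order_trans[rotated])
  then have Ffin: "(\<integral>\<^sup>+u. F u \<partial>?\<sigma>) < \<infinity>" by (simp add: order_le_less_trans)
  define A where "A k = sphere 0 1 \<inter> cball v (1 / real k)" for k
  have Am: "A k \<in> sets ?\<sigma>" for k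
    unfolding A_def sets_spherical_measure by (auto simp: sets_restrict_space)
  \<comment> \<open>From \<open>k0\<close> on, \<open>real k / (2 * R')\<close> is at least
    \<open>T\<close>, so the growth condition is available, and \<open>k\<close> is
    positive.\<close>
  define k0 where "k0 = nat \<lceil>2 * R' * T\<rceil> + 1"
  \<comment> \<open>The factor 2 collects two errors of size \<open>R' / k\<close>: the value of
    \<open>h i\<close> at \<open>v\<close>, eventually below it, and the Lipschitz variation across
    the cap.\<close>
  have Fge: "ennreal (c * (real k / (2 * R')) ^ m) \<le> F u" if k: "k \<ge> k0" and u: "u \<in> A k" for k u
  proof -
    have k': "real k \<ge> 2 * R' * T" "real k > 0" using k R' growth(2) by (auto simp: k0_def) linarith+
    have "R' / real k > 0" using k' R' by simp
    then have "\<forall>\<^sub>F i in sequentially. h i v < R' / real k"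
      using lim unfolding h_def by (rule order_tendstoD(2)[rotated])
    then have "\<forall>\<^sub>F i in sequentially. ennreal (c * (real k / (2 * R')) ^ m) \<le> ennreal (G (1 / h i u) u)"
    proof eventually_elim
      case (elim i)
      have us: "u \<in> sphere 0 1" using u by (simp add: A_def)
      have "\<bar>h i u - h i v\<bar> \<le> R' * norm (u - v)"
        unfolding h_def by (rule support_fun_lipschitz[OF bodies_oD(1,5)[OF M] R'(2)])
      also have "\<dots> \<le> R' * (1 / real k)"
        using u R' by (intro mult_left_mono) (auto simp: A_def dist_norm norm_minus_commute)
      finally have "h i u \<le> 2 * R' / real k" using elim by simp
      then have le: "real k / (2 * R') \<le> 1 / h i u"
        using hpos[OF us, of i] k' R' by (simp add: field_simps)
      moreover have "T \<le> real k / (2 * R')" using k' R' by (simp add: field_simps)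
      ultimately have "c * (1 / h i u) ^ m \<le> G (1 / h i u) u"
        unfolding m_def by (intro growth us) linarith
      moreover have "c * (real k / (2 * R')) ^ m \<le> c * (1 / h i u) ^ m"
        using growth(1) le k' R' by (intro mult_left_mono power_mono) auto
      ultimately show ?case by (intro ennreal_leI) linarith
    qed
    then show ?thesis unfolding F_def by (rule Liminf_bounded)
  qed
  have vA: "v \<in> A k" for k using v by (simp add: A_def)
  \<comment> \<open>This excludes an atom at \<open>v\<close>: as \<open>F\<close> is finite almost
    everywhere, the point is null, and the indicators of the caps tend to 0 almost everywhere. It
    uses \<open>m > 0\<close>, that is, dimension at least 2.\<close>
  have "F v = \<infinity>"
  proof -
    have "m > 0" using dim by (simp add: m_def)
    have "ennreal x \<le> F v" for x
    proof -
      define k where "k = max k0 (nat \<lceil>2 * R' * (\<bar>x\<bar> / c + 1)\<rceil>)"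
      have "real k \<ge> 2 * R' * (\<bar>x\<bar> / c + 1)" unfolding k_def by linarith
      then have kr: "real k / (2 * R') \<ge> \<bar>x\<bar> / c + 1" using R' by (simp add: field_simps)
      have "real k / (2 * R') \<ge> 1" using kr growth(1) by (smt (verit) divide_nonneg_pos abs_ge_zero)
      then have "(real k / (2 * R')) ^ 1 \<le> (real k / (2 * R')) ^ m"
        using \<open>m > 0\<close> by (intro power_increasing) auto
      then have "\<bar>x\<bar> / c \<le> (real k / (2 * R')) ^ m" using kr by simp
      then have "x \<le> c * (real k / (2 * R')) ^ m" using growth(1) by (simp add: field_simps)
      then have "ennreal x \<le> ennreal (c * (real k / (2 * R')) ^ m)" by (rule ennreal_leI)
      also have "\<dots> \<le> F v" by (rule Fge[OF _ vA]) (simp add: k_def)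
      finally show ?thesis .
    qed
    note x = this
    show ?thesis
    proof (cases "F v")
      case (real r)
      then show ?thesis using x[of "r + 1"] by (simp add: ennreal_le_iff)
    qed simp
  qed
  have AEv: "AE u in ?\<sigma>. u \<noteq> v"
    using nn_integral_PInf_AE[OF Fm less_imp_neq[OF Ffin]]
    by eventually_elim (use \<open>F v = \<infinity>\<close> in auto)
  have "(\<lambda>k. \<integral>\<^sup>+u. F u * indicator (A k) u \<partial>?\<sigma>) \<longlonglongrightarrow> (\<integral>\<^sup>+u. 0 \<partial>?\<sigma>)"
  proof (rule nn_integral_dominated_convergence[where w = F])
    show "AE u in ?\<sigma>. (\<lambda>k. F u * indicator (A k) u) \<longlonglongrightarrow> 0"
      using AEv
    proof eventually_elim
      case (elim u)
      then have "dist v u > 0" by simp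
      then obtain N where N: "inverse (real (Suc N)) < dist v u" using reals_Archimedean by blast
      have "indicator (A k) u = (0::ennreal)" if "k \<ge> Suc N" for k
      proof -
        have "1 / real k \<le> inverse (real (Suc N))" using that by (simp add: field_simps)
        then show ?thesis using N by (simp add: A_def)
      qed
      then have "\<forall>\<^sub>F k in sequentially. F u * indicator (A k) u = 0"
        unfolding eventually_sequentially by (metis mult_zero_right)
      then show ?case by (rule tendsto_eventually)
    qed
  qed (use Fm Am Ffin in \<open>auto simp: indicator_def\<close>)
  then have lim0: "(\<lambda>k. \<integral>\<^sup>+u. F u * indicator (A k) u \<partial>?\<sigma>) \<longlonglongrightarrow> 0" by simp
  obtain c' where c': "c' > 0"
    "\<And>(v::'a) N. norm v = 1 \<Longrightarrow> N \<ge> 1 \<Longrightarrow> ennreal (c' * (1 / real N) ^ m) \<le> emeasure ?\<sigma> (sphere 0 1 \<inter> cball v (1 / real N))"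
    using spherical_measure_cap_ge[OF dim] unfolding m_def by blast
  \<comment> \<open>The product of the lower bound for \<open>F\<close> on \<open>A k\<close> with
    the lower bound for the measure of \<open>A k\<close>; the powers of \<open>k\<close>
    cancel.\<close>
  define \<delta> where "\<delta> = c * c' / (2 * R') ^ m"
  have \<delta>: "\<delta> > 0" using growth c' R' by (simp add: \<delta>_def)
  have ge: "ennreal \<delta> \<le> (\<integral>\<^sup>+u. F u * indicator (A k) u \<partial>?\<sigma>)" if k: "k \<ge> k0" for k
  proof -
    have k1: "k \<ge> 1" using k by (simp add: k0_def)
    have "\<delta> = c * (real k / (2 * R')) ^ m * (c' * (1 / real k) ^ m)"
      using k1 by (simp add: \<delta>_def power_divide)
    then have "ennreal \<delta> = ennreal (c * (real k / (2 * R')) ^ m) * ennreal (c' * (1 / real k) ^ m)"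
      using growth(1) R' c'(1) by (simp add: ennreal_mult)
    also have "\<dots> \<le> ennreal (c * (real k / (2 * R')) ^ m) * emeasure ?\<sigma> (A k)"
      unfolding A_def using v k1 by (intro mult_left_mono c') auto
    also have "\<dots> = (\<integral>\<^sup>+u. ennreal (c * (real k / (2 * R')) ^ m) * indicator (A k) u \<partial>?\<sigma>)"
      using Am by (simp add: nn_integral_cmult_indicator)
    also have "\<dots> \<le> (\<integral>\<^sup>+u. F u * indicator (A k) u \<partial>?\<sigma>)"
      using Fge[OF k] by (intro nn_integral_mono) (auto simp: indicator_def)
    finally show ?thesis .
  qed
  have "ennreal \<delta> \<le> 0"
    by (rule LIMSEQ_le_const[OF lim0]) (use ge in blast)
  then show False using \<delta> by simp
qed

section \<open>The Orlicz functional\<close>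

lemma class_ID:
  assumes "\<phi> \<in> class_I"
  shows class_I_pos: "t > 0 \<Longrightarrow> \<phi> t > 0"
    and class_I_le: "0 < s \<Longrightarrow> s \<le> t \<Longrightarrow> \<phi> s \<le> \<phi> t"
    and class_I_continuous: "continuous_on {0<..} \<phi>"
    and class_I_at_top: "filterlim \<phi> at_top at_top"
    and class_I_1: "\<phi> 1 = 1"
proof -
  show "0 < s \<Longrightarrow> s \<le> t \<Longrightarrow> \<phi> s \<le> \<phi> t" for s t
    using assms unfolding class_I_def strict_mono_on_def by (cases "s = t") (auto intro: less_imp_le)
qed (use assms in \<open>auto simp: class_I_def\<close>)

lemma continuous_on_orlicz_integrand:
  assumes \<phi>: "\<phi> \<in> class_I" and K: "K \<in> bodies_o"
  shows "continuous_on (sphere 0 1) (\<lambda>u. \<phi> (support_fun K u))"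
proof (rule continuous_on_compose2[OF class_I_continuous[OF \<phi>]])
  show "continuous_on (sphere 0 1) (support_fun K)"
    by (rule continuous_on_support_fun[OF bodies_oD(1,5)[OF K]])
  show "support_fun K ` sphere 0 1 \<subseteq> {0<..}"
    using support_fun_pos_sphere[OF K] by auto
qed

lemma orlicz_functional_nonneg:
  assumes \<phi>: "\<phi> \<in> class_I" and K: "K \<in> bodies_o" and \<mu>: "finite_sphere_measure \<mu>"
  shows "orlicz_functional \<phi> \<mu> K \<ge> 0"
proof -
  have "(\<integral>u. 0 \<partial>\<mu>) \<le> orlicz_functional \<phi> \<mu> K"
    unfolding orlicz_functional_def
  proof (rule integral_mono_on_sphere[OF \<mu> _ continuous_on_orlicz_integrand[OF \<phi> K]])
    fix u :: 'a assume "u \<in> sphere 0 1"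
    then show "0 \<le> \<phi> (support_fun K u)"
      by (intro less_imp_le class_I_pos[OF \<phi>] support_fun_pos_sphere[OF K])
  qed auto
  then show ?thesis by simp
qed

text \<open>Eliminates polar bodies and radial functions: from here on the constraint is one on
  support functions, which are what converges.\<close>

lemma B_tilde_iff:
  "Q \<in> B_tilde G \<longleftrightarrow> Q \<in> bodies_o \<and>
     (\<integral>u. G (1 / support_fun Q u) u \<partial>spherical_measure) = (\<integral>u. G 1 u \<partial>spherical_measure)"
proof -
  have "dual_vol G (polar_body Q) = (\<integral>u. G (1 / support_fun Q u) u \<partial>spherical_measure)"
    if "Q \<in> bodies_o"
    unfolding dual_vol_def
  proof (rule Bochner_Integration.integral_cong[OF refl])
    fix u :: 'a assume "u \<in> space spherical_measure"
    then have "u \<noteq> 0" by auto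
    then show "G (radial_fun (polar_body Q) u) u = G (1 / support_fun Q u) u"
      by (simp add: radial_fun_polar_body[OF that])
  qed
  moreover have "dual_vol G (cball 0 1) = (\<integral>u. G 1 u \<partial>spherical_measure)"
    unfolding dual_vol_def
    by (intro Bochner_Integration.integral_cong) (auto simp: radial_fun_cball)
  ultimately show ?thesis by (auto simp: B_tilde_def)
qed

text \<open>The unit ball is the fixed competitor that bounds all minimal values.\<close>

lemma cball_in_B_tilde: "cball 0 1 \<in> B_tilde G"
proof -
  have "(\<integral>u. G (1 / support_fun (cball 0 1) u) u \<partial>spherical_measure) = (\<integral>u. G 1 u \<partial>spherical_measure)"
    by (intro Bochner_Integration.integral_cong) (auto simp: support_fun_cball)
  then show ?thesis by (simp add: B_tilde_iff cball_in_bodies_o)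
qed

lemma orlicz_functional_cball:
  assumes "\<phi> \<in> class_I" "finite_sphere_measure \<mu>"
  shows "orlicz_functional \<phi> \<mu> (cball 0 1) = measure \<mu> (sphere 0 1)"
proof -
  have "orlicz_functional \<phi> \<mu> (cball 0 1) = (\<integral>u. 1 \<partial>\<mu>)"
    unfolding orlicz_functional_def
    by (intro Bochner_Integration.integral_cong)
       (auto simp: space_finite_sphere_measure[OF assms(2)] support_fun_cball class_I_1[OF assms(1)])
  then show ?thesis unfolding integral_const_on_sphere[OF assms(2)] by simp
qed

section \<open>Boundedness of the minimisers\<close>

text \<open>Restates the hemisphere condition through a continuous test function, the form that weak
  convergence can handle. If the integral of this nonnegative function were 0, the open hemisphere
  would be null.\<close>

lemma integral_pos_part_inner_pos:
  fixes \<mu> :: "'a::euclidean_space measure"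
  assumes \<mu>: "finite_sphere_measure \<mu>" "not_conc_hemisphere \<mu>" and v: "v \<in> sphere 0 1"
  shows "(\<integral>u. max 0 (u \<bullet> v) \<partial>\<mu>) > 0"
proof -
  have c: "continuous_on (sphere 0 1) (\<lambda>u. max 0 (u \<bullet> v))" by (intro continuous_intros)
  have "(\<integral>u. max 0 (u \<bullet> v) \<partial>\<mu>) \<ge> 0" by (intro Bochner_Integration.integral_nonneg) auto
  moreover have "(\<integral>u. max 0 (u \<bullet> v) \<partial>\<mu>) \<noteq> 0"
  proof
    assume "(\<integral>u. max 0 (u \<bullet> v) \<partial>\<mu>) = 0"
    then have "AE u in \<mu>. max 0 (u \<bullet> v) = 0"
      by (subst (asm) integral_nonneg_eq_0_iff_AE) (auto intro: integrable_on_sphere \<mu> c)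
    then have "AE u in \<mu>. u \<notin> {u \<in> sphere 0 1. u \<bullet> v > 0}"
      by eventually_elim auto
    moreover have "{u \<in> sphere 0 1. u \<bullet> v > 0} \<in> sets \<mu>"
    proof -
      have "{u. u \<bullet> v > 0} \<in> sets borel" by simp
      moreover have "{u \<in> sphere 0 1. u \<bullet> v > 0} = sphere 0 1 \<inter> {u. u \<bullet> v > 0}" by auto
      ultimately show ?thesis
        using \<mu>(1) unfolding finite_sphere_measure_def by (auto simp: sets_restrict_space)
    qed
    ultimately have "measure \<mu> {u \<in> sphere 0 1. u \<bullet> v > 0} = 0"
      by (simp add: AE_iff_measurable[OF _ refl] measure_def AE_not_in AE_iff_null_sets null_setsD1)
    then show False using \<mu>(2) v unfolding not_conc_hemisphere_def by (metis less_irrefl)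
  qed
  ultimately show ?thesis by linarith
qed

text \<open>
  With \<open>x \<in> K\<close> of norm \<open>R\<close> and direction \<open>v\<close>, the support function dominates \<open>R \<langle>u, v\<rangle>\<close>. Since
  \<open>\<langle>u, v\<rangle>\<^sub>+ - a\<close> is at most \<open>1\<close>, and negative wherever \<open>\<langle>u, v\<rangle> < a\<close>, the integrand is at least
  \<open>\<phi> (R a) (\<langle>u, v\<rangle>\<^sub>+ - a)\<close>.
\<close>
lemma orlicz_functional_ge:
  fixes \<mu> :: "'a::euclidean_space measure"
  assumes \<phi>: "\<phi> \<in> class_I" and K: "K \<in> bodies_o" and \<mu>: "finite_sphere_measure \<mu>"
    and x: "x \<in> K" "x = R *\<^sub>R v" "v \<in> sphere 0 1" and pos: "R > 0" "a > 0"
  shows "\<phi> (R * a) * ((\<integral>u. max 0 (u \<bullet> v) \<partial>\<mu>) - a * measure \<mu> (sphere 0 1)) \<le> orlicz_functional \<phi> \<mu> K"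
proof -
  have c: "continuous_on (sphere 0 1) (\<lambda>u::'a. max 0 (u \<bullet> v))" by (intro continuous_intros)
  have "(\<integral>u. \<phi> (R * a) * (max 0 (u \<bullet> v) - a) \<partial>\<mu>) \<le> orlicz_functional \<phi> \<mu> K"
    unfolding orlicz_functional_def
  proof (rule integral_mono_on_sphere[OF \<mu> _ continuous_on_orlicz_integrand[OF \<phi> K]])
    fix u :: 'a assume u: "u \<in> sphere 0 1"
    then have h: "\<phi> (support_fun K u) > 0"
      by (intro class_I_pos[OF \<phi>] support_fun_pos_sphere[OF K])
    have p: "\<phi> (R * a) > 0" using pos class_I_pos[OF \<phi>] by simp
    show "\<phi> (R * a) * (max 0 (u \<bullet> v) - a) \<le> \<phi> (support_fun K u)"
    proof (cases "u \<bullet> v \<ge> a")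
      case True
      have "R * a \<le> R * (u \<bullet> v)" using True pos by simp
      also have "\<dots> = x \<bullet> u" using x by (simp add: inner_commute)
      also have "\<dots> \<le> support_fun K u" by (rule support_fun_upper[OF bodies_oD(1,5)[OF K] x(1)])
      finally have "\<phi> (R * a) \<le> \<phi> (support_fun K u)" using pos by (intro class_I_le[OF \<phi>]) auto
      moreover have "u \<bullet> v \<le> 1" using norm_cauchy_schwarz[of u v] u x by simp
      then have "\<phi> (R * a) * (max 0 (u \<bullet> v) - a) \<le> \<phi> (R * a) * 1"
        using p pos by (intro mult_left_mono) auto
      ultimately show ?thesis by simp
    next
      case False
      then have "\<phi> (R * a) * (max 0 (u \<bullet> v) - a) \<le> 0"
        using p pos by (intro mult_nonneg_nonpos) auto
      then show ?thesis using h by linarith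
    qed
  qed (intro continuous_intros)
  moreover have "(\<integral>u. \<phi> (R * a) * (max 0 (u \<bullet> v) - a) \<partial>\<mu>) =
      \<phi> (R * a) * ((\<integral>u. max 0 (u \<bullet> v) \<partial>\<mu>) - (\<integral>u. a \<partial>\<mu>))"
    unfolding integral_mult_right_zero
    by (subst Bochner_Integration.integral_diff)
       (intro integrable_on_sphere[OF \<mu>] c continuous_intros refl)+
  ultimately show ?thesis
    unfolding integral_const_on_sphere[OF \<mu>] by (simp only: mult.commute)
qed

text \<open>Apply \<open>orlicz_functional_ge\<close> to a farthest point of each body. Along a
  subsequence the directions converge, so the test functions converge uniformly and their integrals
  against the varying measures tend to the positive number \<open>I\<close>. With the functionals
  bounded, \<open>\<phi>\<close> stays bounded at a multiple of the farthest norms, and it tends to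
  infinity.\<close>

lemma minimizers_bounded_subseq:
  fixes \<mu>s :: "nat \<Rightarrow> 'a::euclidean_space measure" and M :: "nat \<Rightarrow> 'a set"
  assumes fin: "\<And>i. finite_sphere_measure (\<mu>s i)" "finite_sphere_measure \<mu>"
    and nc: "not_conc_hemisphere \<mu>" and weak: "sphere_weak_conv \<mu>s \<mu>" and \<phi>: "\<phi> \<in> class_I"
    and M: "\<And>i. M i \<in> bodies_o" and bd: "\<And>i. orlicz_functional \<phi> (\<mu>s i) (M i) \<le> C"
  obtains r R where "strict_mono (r :: nat \<Rightarrow> nat)" "\<And>i x. x \<in> M (r i) \<Longrightarrow> norm x \<le> R"
proof -
  have "\<exists>x\<in>M i. x \<noteq> 0 \<and> (\<forall>y\<in>M i. norm y \<le> norm x)" for i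
  proof -
    obtain x where x: "x \<in> M i" "\<And>y. y \<in> M i \<Longrightarrow> norm y \<le> norm x"
      using continuous_attains_sup[OF bodies_oD(1,5)[OF M[of i]], of norm] by (auto intro: continuous_intros)
    obtain e where e: "e > 0" "cball 0 e \<subseteq> M i"
      using bodies_oD(3)[OF M] mem_interior_cball by blast
    obtain b :: 'a where b: "norm b = 1" using vector_choose_size[of 1] by auto
    have "e *\<^sub>R b \<in> M i" using e b by auto
    then have "e \<le> norm x" using x(2)[of "e *\<^sub>R b"] e b by simp
    then have "x \<noteq> 0" using e(1) by auto
    then show ?thesis using x by blast
  qed
  then obtain x where x: "\<And>i. x i \<in> M i" "\<And>i. x i \<noteq> 0" "\<And>i y. y \<in> M i \<Longrightarrow> norm y \<le> norm (x i)"
    by metis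
  define v where "v i = x i /\<^sub>R norm (x i)" for i
  have v: "v i \<in> sphere 0 1" for i using x(2) by (simp add: v_def)
  obtain w and r :: "nat \<Rightarrow> nat" where w: "w \<in> sphere 0 1" and r: "strict_mono r" "(v \<circ> r) \<longlonglongrightarrow> w"
    using compact_sphere[of "0::'a" 1] v unfolding compact_def by metis
  define I where "I = (\<integral>u. max 0 (u \<bullet> w) \<partial>\<mu>)"
  have I: "I > 0" unfolding I_def by (rule integral_pos_part_inner_pos[OF fin(2) nc w])
  have c: "continuous_on (sphere 0 1) (\<lambda>u::'a. max 0 (u \<bullet> z))" for z by (intro continuous_intros)
  have "uniform_limit (sphere 0 1) (\<lambda>i u. max 0 (u \<bullet> v (r i))) (\<lambda>u. max 0 (u \<bullet> w)) sequentially"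
  proof (rule uniform_limitI)
    fix e :: real assume "e > 0"
    then have "\<forall>\<^sub>F i in sequentially. dist (v (r i)) w < e"
      using r(2) by (auto simp: tendsto_iff o_def)
    then show "\<forall>\<^sub>F i in sequentially. \<forall>u\<in>sphere 0 1. dist (max 0 (u \<bullet> v (r i))) (max 0 (u \<bullet> w)) < e"
    proof eventually_elim
      case (elim i)
      show ?case
      proof
        fix u :: 'a assume u: "u \<in> sphere 0 1"
        have "dist (max 0 (u \<bullet> v (r i))) (max 0 (u \<bullet> w)) \<le> \<bar>u \<bullet> v (r i) - u \<bullet> w\<bar>"
          by (auto simp: dist_real_def)
        also have "\<dots> = \<bar>u \<bullet> (v (r i) - w)\<bar>" by (simp add: inner_diff_right)
        also have "\<dots> \<le> norm u * norm (v (r i) - w)" by (rule Cauchy_Schwarz_ineq2)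
        also have "\<dots> < e" using u elim by (simp add: dist_norm)
        finally show "dist (max 0 (u \<bullet> v (r i))) (max 0 (u \<bullet> w)) < e" .
      qed
    qed
  qed
  then have limI: "(\<lambda>i. \<integral>u. max 0 (u \<bullet> v (r i)) \<partial>\<mu>s (r i)) \<longlonglongrightarrow> I"
    unfolding I_def
    by (intro sphere_weak_conv_uniform_limit[OF sphere_weak_conv_subseq[OF weak r(1)]] fin c)
  define m where "m = measure \<mu> (sphere 0 1) + 1"
  have m: "m > 0" by (simp add: m_def add_nonneg_pos)
  have limm: "(\<lambda>i. measure (\<mu>s (r i)) (sphere 0 1)) \<longlonglongrightarrow> measure \<mu> (sphere 0 1)"
    by (intro sphere_weak_conv_measure[OF sphere_weak_conv_subseq[OF weak r(1)]] fin)
  \<comment> \<open>Eventually the integrals exceed \<open>I / 2\<close> and the masses are below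
    \<open>m\<close>; this \<open>a\<close> makes \<open>a * m = I / 4\<close>, so the difference in
    the lower bound is at least \<open>I / 4\<close>.\<close>
  define a where "a = I / (4 * m)"
  have a: "a > 0" using I m by (simp add: a_def)
  have "\<forall>\<^sub>F t in at_top. \<phi> t > 4 * \<bar>C\<bar> / I"
    using class_I_at_top[OF \<phi>] unfolding filterlim_at_top_dense by blast
  then obtain X where X: "\<And>t. t \<ge> X \<Longrightarrow> \<phi> t > 4 * \<bar>C\<bar> / I"
    unfolding eventually_at_top_linorder by blast
  have "\<forall>\<^sub>F i in sequentially. (\<integral>u. max 0 (u \<bullet> v (r i)) \<partial>\<mu>s (r i)) > I / 2"
    using limI I by (intro order_tendstoD(1)) auto
  moreover have "\<forall>\<^sub>F i in sequentially. measure (\<mu>s (r i)) (sphere 0 1) < m"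
    using limm by (intro order_tendstoD(2)) (auto simp: m_def)
  ultimately have "\<forall>\<^sub>F i in sequentially. norm (x (r i)) \<le> X / a"
  proof eventually_elim
    case (elim i)
    let ?R = "norm (x (r i))"
    have R: "?R > 0" using x(2) by simp
    have p: "\<phi> (?R * a) > 0" using R a by (intro class_I_pos[OF \<phi>]) auto
    have "a * measure (\<mu>s (r i)) (sphere 0 1) \<le> a * m" using a elim by (intro mult_left_mono) auto
    also have "\<dots> = I / 4" using m by (simp add: a_def)
    finally have "I / 4 \<le> (\<integral>u. max 0 (u \<bullet> v (r i)) \<partial>\<mu>s (r i)) - a * measure (\<mu>s (r i)) (sphere 0 1)"
      using elim by linarith
    then have "\<phi> (?R * a) * (I / 4) \<le> \<phi> (?R * a) *
        ((\<integral>u. max 0 (u \<bullet> v (r i)) \<partial>\<mu>s (r i)) - a * measure (\<mu>s (r i)) (sphere 0 1))"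
      using p by (intro mult_left_mono) auto
    also have "\<dots> \<le> orlicz_functional \<phi> (\<mu>s (r i)) (M (r i))"
      using x R a v by (intro orlicz_functional_ge[OF \<phi> M fin(1), of "x (r i)"]) (auto simp: v_def)
    also have "\<dots> \<le> \<bar>C\<bar>" using bd[of "r i"] by linarith
    finally have "\<phi> (?R * a) \<le> 4 * \<bar>C\<bar> / I" using I by (simp add: field_simps)
    then have "?R * a < X" using X[of "?R * a"] by force
    then show ?case using a by (simp add: field_simps)
  qed
  then obtain N where N: "\<And>i. i \<ge> N \<Longrightarrow> norm (x (r i)) \<le> X / a"
    unfolding eventually_sequentially by blast
  show ?thesis
  proof (rule that[of "\<lambda>i. r (i + N)" "X / a"])
    show "strict_mono (\<lambda>i. r (i + N))" using r(1) by (auto simp: strict_mono_def)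
    show "norm y \<le> X / a" if "y \<in> M (r (i + N))" for i y
      using x(3)[OF that] N[of "i + N"] by simp
  qed
qed

section \<open>Stability of minimisers\<close>

text \<open>Once the limiting support function is known to be positive, compactness keeps it away
  from 0. Then the reciprocals eventually stay in a compact subinterval of the positive axis, and
  the integral constraint passes to the limit.\<close>

lemma limit_body:
  fixes M :: "nat \<Rightarrow> 'a::euclidean_space set" and G :: "real \<Rightarrow> 'a \<Rightarrow> real"
  assumes dim: "DIM('a) \<ge> 2" and G: "G \<in> class_GI"
    and growth: "c > 0" "T > 0" "\<And>t u. t \<ge> T \<Longrightarrow> u \<in> sphere 0 1 \<Longrightarrow> c * t ^ (DIM('a) - 1) \<le> G t u"
    and M: "\<And>i. M i \<in> B_tilde G" and R: "\<And>i x. x \<in> M i \<Longrightarrow> norm x \<le> R"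
  obtains r K where "strict_mono (r :: nat \<Rightarrow> nat)" "K \<in> B_tilde G"
    "uniform_limit (sphere 0 1) (\<lambda>i. support_fun (M (r i))) (support_fun K) sequentially"
proof -
  let ?\<sigma> = "spherical_measure :: 'a measure"
  have Mb: "M i \<in> bodies_o"
    and MG: "(\<integral>u. G (1 / support_fun (M i) u) u \<partial>?\<sigma>) = (\<integral>u. G 1 u \<partial>?\<sigma>)" for i
    using M[of i] by (auto simp: B_tilde_iff)
  obtain K r where K: "compact K" "convex K" "K \<noteq> {}" and r: "strict_mono r"
    and ul: "uniform_limit (sphere 0 1) (\<lambda>i. support_fun (M (r i))) (support_fun K) sequentially"
    and Keq: "K = {x. \<forall>v\<in>sphere 0 1. x \<bullet> v \<le> support_fun K v}"
    by (rule blaschke_selection[of M R, OF bodies_oD(1)[OF Mb] bodies_oD(5)[OF Mb]],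
        erule R, rule that; assumption)
  have hpos: "support_fun K u > 0" if u: "u \<in> sphere 0 1" for u
  proof (rule ccontr)
    have lim: "(\<lambda>i. support_fun (M (r i)) u) \<longlonglongrightarrow> support_fun K u"
      by (rule tendsto_uniform_limitI[OF ul u])
    have "support_fun K u \<ge> 0"
      by (rule LIMSEQ_le_const[OF lim]) (auto intro!: less_imp_le support_fun_pos_sphere[OF Mb] u)
    moreover assume "\<not> support_fun K u > 0"
    ultimately have "(\<lambda>i. support_fun (M (r i)) u) \<longlonglongrightarrow> 0" using lim by simp
    moreover have "\<not> (\<lambda>i. support_fun (M (r i)) u) \<longlonglongrightarrow> 0"
      by (rule support_fun_not_tendsto_0[OF dim G growth Mb R _ u]) (auto simp: MG)
    ultimately show False by blast
  qed
  have hcont: "continuous_on (sphere 0 1) (support_fun K)"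
    by (rule continuous_on_support_fun[OF K(1,3)])
  have ne: "sphere (0::'a) 1 \<noteq> {}" by simp
  obtain z where z: "z \<in> sphere 0 1" "\<And>u. u \<in> sphere 0 1 \<Longrightarrow> support_fun K z \<le> support_fun K u"
    using continuous_attains_inf[OF compact_sphere ne hcont] by blast
  obtain b where b: "\<And>u. u \<in> sphere 0 1 \<Longrightarrow> \<bar>support_fun K u\<bar> \<le> b"
    using continuous_on_sphere_bounded[OF hcont] by blast
  define a where "a = support_fun K z"
  have a: "a > 0" "\<And>u. u \<in> sphere 0 1 \<Longrightarrow> a \<le> support_fun K u"
    using z hpos by (auto simp: a_def)
  \<comment> \<open>The description of \<open>K\<close> by half-spaces turns a lower bound on its
    support function into an inclusion.\<close>
  have "cball 0 a \<subseteq> K"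
  proof
    fix x :: 'a assume x: "x \<in> cball 0 a"
    have "x \<bullet> v \<le> support_fun K v" if "v \<in> sphere 0 1" for v
      using norm_cauchy_schwarz[of x v] a(2)[OF that] that x by simp
    then show "x \<in> K" by (subst Keq) blast
  qed
  then have "0 \<in> interior K" using a(1) mem_interior_cball by blast
  then have Kb: "K \<in> bodies_o" using K by (simp add: bodies_o_def)
  have "\<forall>\<^sub>F i in sequentially. \<forall>u\<in>sphere 0 1. dist (support_fun (M (r i)) u) (support_fun K u) < a / 2"
    using uniform_limitD[OF ul, of "a / 2"] a(1) by simp
  then obtain N where N: "\<And>i u. i \<ge> N \<Longrightarrow> u \<in> sphere 0 1 \<Longrightarrow>
      dist (support_fun (M (r i)) u) (support_fun K u) < a / 2"
    unfolding eventually_sequentially by blast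
  \<comment> \<open>Dropping the first \<open>N\<close> terms makes the two-sided bounds hold for
    every index, as the convergence lemma asks.\<close>
  define s where "s i = r (i + N)" for i
  have s: "strict_mono s" using r by (auto simp: strict_mono_def s_def)
  have uls: "uniform_limit (sphere 0 1) (\<lambda>i. support_fun (M (s i))) (support_fun K) sequentially"
    unfolding s_def by (rule filterlim_compose[OF ul filterlim_add_const_nat_at_top])
  have bounds: "a / 2 \<le> support_fun (M (s i)) u \<and> support_fun (M (s i)) u \<le> b + a / 2"
    if u: "u \<in> sphere 0 1" for i u
  proof -
    have "\<bar>support_fun (M (s i)) u - support_fun K u\<bar> < a / 2"
      using N[of "i + N", OF _ u] by (simp add: s_def dist_real_def)
    then show ?thesis using a(2)[OF u] b[OF u] unfolding abs_le_iff abs_less_iff by linarith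
  qed
  have "(\<lambda>i. \<integral>u. G (1 / support_fun (M (s i)) u) u \<partial>?\<sigma>) \<longlonglongrightarrow> (\<integral>u. G (1 / support_fun K u) u \<partial>?\<sigma>)"
  proof (rule class_GI_integral_tendsto[OF G finite_sphere_measure_spherical, where a = "1 / (b + a / 2)" and b = "2 / a"])
    have b0: "b + a / 2 > 0" using a b[OF z(1)] by linarith
    then show "1 / (b + a / 2) > 0" by simp
    show "1 / (b + a / 2) \<le> 1 / support_fun (M (s i)) u \<and> 1 / support_fun (M (s i)) u \<le> 2 / a"
      if u: "u \<in> sphere 0 1" for i u
    proof -
      have p: "support_fun (M (s i)) u > 0" by (rule support_fun_pos_sphere[OF Mb u])
      have "1 / (b + a / 2) \<le> 1 / support_fun (M (s i)) u"
        using bounds[OF u, of i] p by (intro divide_left_mono) auto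
      moreover have "1 / support_fun (M (s i)) u \<le> 1 / (a / 2)"
        using bounds[OF u, of i] p a by (intro divide_left_mono) auto
      ultimately show ?thesis by simp
    qed
    show "continuous_on (sphere 0 1) (\<lambda>u. 1 / support_fun (M (s i)) u)" for i
      using support_fun_pos_sphere[OF Mb, of _ "s i"]
      by (intro continuous_intros continuous_on_support_fun[OF bodies_oD(1,5)[OF Mb]]) force
    show "continuous_on (sphere 0 1) (\<lambda>u. 1 / support_fun K u)"
      using hpos by (intro continuous_intros hcont) force
    show "(\<lambda>i. 1 / support_fun (M (s i)) u) \<longlonglongrightarrow> 1 / support_fun K u" if u: "u \<in> sphere 0 1" for u
      using hpos[OF u] by (intro tendsto_intros tendsto_uniform_limitI[OF uls u]) auto
  qed
  then have "(\<integral>u. G (1 / support_fun K u) u \<partial>?\<sigma>) = (\<integral>u. G 1 u \<partial>?\<sigma>)"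
    unfolding MG by (simp add: LIMSEQ_const_iff)
  then have "K \<in> B_tilde G" using Kb by (simp add: B_tilde_iff)
  then show ?thesis using s uls that by blast
qed

text \<open>\<open>\<phi>\<close> is controlled on positive arguments only. Eventually all values
  lie in a compact interval of positive numbers, where \<open>\<phi>\<close> is uniformly
  continuous, so uniform convergence survives the composition.\<close>

lemma orlicz_functional_tendsto:
  fixes \<mu>s :: "nat \<Rightarrow> 'a::euclidean_space measure" and M :: "nat \<Rightarrow> 'a set"
  assumes fin: "finite_sphere_measure \<mu>" "\<And>i. finite_sphere_measure (\<mu>s i)"
    and weak: "sphere_weak_conv \<mu>s \<mu>" and \<phi>: "\<phi> \<in> class_I"
    and M: "\<And>i. M i \<in> bodies_o" and K: "K \<in> bodies_o"
    and ul: "uniform_limit (sphere 0 1) (\<lambda>i. support_fun (M i)) (support_fun K) sequentially"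
  shows "(\<lambda>i. orlicz_functional \<phi> (\<mu>s i) (M i)) \<longlonglongrightarrow> orlicz_functional \<phi> \<mu> K"
proof -
  obtain a b where ab: "0 < a" "\<And>u. u \<in> sphere 0 1 \<Longrightarrow> a \<le> support_fun K u \<and> support_fun K u \<le> b"
    using support_fun_bounds[OF K] by blast
  have "uniform_limit (sphere 0 1) (\<lambda>i u. \<phi> (support_fun (M i) u)) (\<lambda>u. \<phi> (support_fun K u)) sequentially"
  proof (rule uniform_limit_compose_uniformly_continuous_on[OF ul])
    have "continuous_on {a/2..b + a/2} \<phi>"
      using ab by (intro continuous_on_subset[OF class_I_continuous[OF \<phi>]]) auto
    then show "uniformly_continuous_on {a/2..b + a/2} \<phi>"
      by (rule compact_uniformly_continuous) simp
    have "\<forall>\<^sub>F i in sequentially. \<forall>u\<in>sphere 0 1. dist (support_fun (M i) u) (support_fun K u) < a / 2"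
      using uniform_limitD[OF ul, of "a / 2"] ab(1) by simp
    then show "\<forall>\<^sub>F i in sequentially. \<forall>u\<in>sphere 0 1. support_fun (M i) u \<in> {a/2..b + a/2}"
    proof eventually_elim
      case (elim i)
      show ?case
      proof
        fix u :: 'a assume "u \<in> sphere 0 1"
        then have "a \<le> support_fun K u" "support_fun K u \<le> b"
            "\<bar>support_fun (M i) u - support_fun K u\<bar> < a / 2"
          using ab(2)[of u] bspec[OF elim, of u] by (auto simp only: dist_real_def)
        then show "support_fun (M i) u \<in> {a/2..b + a/2}"
          unfolding abs_less_iff atLeastAtMost_iff by linarith
      qed
    qed
  qed simp
  then show ?thesis
    unfolding orlicz_functional_def
    by (intro sphere_weak_conv_uniform_limit[OF weak fin] continuous_on_orlicz_integrand \<phi> M K)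
qed

text \<open>At the unit ball the functional equals the mass of the measure, so the minimal values
  are bounded. Optimality passes to the limit because the functional of any fixed competitor
  \<open>Q\<close> converges as well.\<close>

lemma minimizer_stability_subseq:
  fixes \<mu>s :: "nat \<Rightarrow> 'a::euclidean_space measure" and M :: "nat \<Rightarrow> 'a set" and G :: "real \<Rightarrow> 'a \<Rightarrow> real"
  assumes dim: "DIM('a) \<ge> 2" and G: "G \<in> class_GI"
    and growth: "c > 0" "T > 0" "\<And>t u. t \<ge> T \<Longrightarrow> u \<in> sphere 0 1 \<Longrightarrow> c * t ^ (DIM('a) - 1) \<le> G t u"
    and fin: "\<And>i. finite_sphere_measure (\<mu>s i)" "finite_sphere_measure \<mu>"
    and nc: "not_conc_hemisphere \<mu>" and weak: "sphere_weak_conv \<mu>s \<mu>" and \<phi>: "\<phi> \<in> class_I"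
    and M: "\<And>i. M i \<in> B_tilde G"
    and min: "\<And>i Q. Q \<in> B_tilde G \<Longrightarrow> orlicz_functional \<phi> (\<mu>s i) (M i) \<le> orlicz_functional \<phi> (\<mu>s i) Q"
  obtains r K where "strict_mono (r :: nat \<Rightarrow> nat)" "K \<in> B_tilde G"
    "\<And>Q. Q \<in> B_tilde G \<Longrightarrow> orlicz_functional \<phi> \<mu> K \<le> orlicz_functional \<phi> \<mu> Q"
    "(\<lambda>i. orlicz_functional \<phi> (\<mu>s (r i)) (M (r i))) \<longlonglongrightarrow> orlicz_functional \<phi> \<mu> K"
proof -
  have body: "Q \<in> bodies_o" if "Q \<in> B_tilde G" for Q using that by (simp add: B_tilde_iff)
  obtain C where C: "C > 0" "\<And>i. norm (measure (\<mu>s i) (sphere 0 1)) \<le> C"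
    using Bseq_def convergent_imp_Bseq[OF convergentI[OF sphere_weak_conv_measure[OF weak fin(2,1)]]] by metis
  have bd: "orlicz_functional \<phi> (\<mu>s i) (M i) \<le> C" for i
    using min[OF cball_in_B_tilde, of i] C(2)[of i] orlicz_functional_cball[OF \<phi> fin(1), of i] by simp
  obtain r1 :: "nat \<Rightarrow> nat" and R where r1: "strict_mono r1" "\<And>i x. x \<in> M (r1 i) \<Longrightarrow> norm x \<le> R"
    using minimizers_bounded_subseq[OF fin nc weak \<phi>, of M C] body[OF M] bd by blast
  obtain r2 :: "nat \<Rightarrow> nat" and K where r2: "strict_mono r2" and K: "K \<in> B_tilde G"
    and ul: "uniform_limit (sphere 0 1) (\<lambda>i. support_fun (M (r1 (r2 i)))) (support_fun K) sequentially"
  proof (rule limit_body[OF dim G growth, of "\<lambda>i. M (r1 i)" R])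
    show "M (r1 i) \<in> B_tilde G" for i by (rule M)
    show "norm x \<le> R" if "x \<in> M (r1 i)" for i x by (rule r1(2)[OF that])
  qed
  define r where "r i = r1 (r2 i)" for i
  have r: "strict_mono r" using r1(1) r2 by (auto simp: strict_mono_def r_def)
  note weak' = sphere_weak_conv_subseq[OF weak r]
  have lim: "(\<lambda>i. orlicz_functional \<phi> (\<mu>s (r i)) (M (r i))) \<longlonglongrightarrow> orlicz_functional \<phi> \<mu> K"
    using ul unfolding r_def[symmetric]
    by (intro orlicz_functional_tendsto[OF fin(2,1) weak' \<phi>] body M K)
  have "orlicz_functional \<phi> \<mu> K \<le> orlicz_functional \<phi> \<mu> Q" if Q: "Q \<in> B_tilde G" for Q
  proof (rule LIMSEQ_le[OF lim])
    show "(\<lambda>i. orlicz_functional \<phi> (\<mu>s (r i)) Q) \<longlonglongrightarrow> orlicz_functional \<phi> \<mu> Q"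
      by (intro orlicz_functional_tendsto[OF fin(2,1) weak' \<phi>] body Q uniform_limit_const)
    show "\<exists>N. \<forall>i\<ge>N. orlicz_functional \<phi> (\<mu>s (r i)) (M (r i)) \<le> orlicz_functional \<phi> (\<mu>s (r i)) Q"
      using min[OF Q] by blast
  qed
  then show ?thesis using that r K lim by blast
qed

text \<open>A subsequence whose values stay away from the minimum for \<open>\<mu>\<close> would, by
  the subsequence version, have a further subsequence whose values tend to that very
  minimum.\<close>

lemma minimizer_stability:
  fixes \<mu>s :: "nat \<Rightarrow> 'a::euclidean_space measure" and M :: "nat \<Rightarrow> 'a set" and G :: "real \<Rightarrow> 'a \<Rightarrow> real"
  assumes dim: "DIM('a) \<ge> 2" and G: "G \<in> class_GI"
    and growth: "c > 0" "T > 0" "\<And>t u. t \<ge> T \<Longrightarrow> u \<in> sphere 0 1 \<Longrightarrow> c * t ^ (DIM('a) - 1) \<le> G t u"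
    and fin: "\<And>i. finite_sphere_measure (\<mu>s i)" "finite_sphere_measure \<mu>"
    and nc: "not_conc_hemisphere \<mu>" and weak: "sphere_weak_conv \<mu>s \<mu>" and \<phi>: "\<phi> \<in> class_I"
    and M: "\<And>i. M i \<in> B_tilde G"
    and min: "\<And>i. orlicz_functional \<phi> (\<mu>s i) (M i) = (INF Q\<in>B_tilde G. orlicz_functional \<phi> (\<mu>s i) Q)"
  shows "\<exists>M'\<in>B_tilde G. orlicz_functional \<phi> \<mu> M' = (INF Q\<in>B_tilde G. orlicz_functional \<phi> \<mu> Q) \<and>
    (\<lambda>i. orlicz_functional \<phi> (\<mu>s i) (M i)) \<longlonglongrightarrow> orlicz_functional \<phi> \<mu> M'"
proof -
  \<comment> \<open>A real \<open>INF\<close> is a lower bound only if the values are bounded below;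
    here they are nonnegative.\<close>
  have min': "orlicz_functional \<phi> (\<mu>s i) (M i) \<le> orlicz_functional \<phi> (\<mu>s i) Q" if "Q \<in> B_tilde G" for i Q
    unfolding min
  proof (rule cINF_lower[OF _ that])
    show "bdd_below (orlicz_functional \<phi> (\<mu>s i) ` B_tilde G)"
      using orlicz_functional_nonneg[OF \<phi> _ fin(1)] by (intro bdd_belowI2[of _ 0]) (auto simp: B_tilde_iff)
  qed
  obtain r K where K: "K \<in> B_tilde G"
    "\<And>Q. Q \<in> B_tilde G \<Longrightarrow> orlicz_functional \<phi> \<mu> K \<le> orlicz_functional \<phi> \<mu> Q"
    using minimizer_stability_subseq[OF dim G growth fin nc weak \<phi> M min'] by metis
  have "(\<lambda>i. orlicz_functional \<phi> (\<mu>s i) (M i)) \<longlonglongrightarrow> orlicz_functional \<phi> \<mu> K"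
  proof (rule ccontr)
    assume "\<not> ?thesis"
    then obtain e where e: "e > 0" "\<not> (\<exists>N. \<forall>i\<ge>N. dist (orlicz_functional \<phi> (\<mu>s i) (M i)) (orlicz_functional \<phi> \<mu> K) < e)"
      unfolding lim_sequentially by blast
    define S where "S = {i. dist (orlicz_functional \<phi> (\<mu>s i) (M i)) (orlicz_functional \<phi> \<mu> K) \<ge> e}"
    have "infinite S"
      unfolding infinite_nat_iff_unbounded_le using e(2) by (force simp: S_def not_less)
    then obtain s :: "nat \<Rightarrow> nat" where s: "strict_mono s" "\<And>n. s n \<in> S"
      using infinite_enumerate by blast
    obtain t K' where K': "K' \<in> B_tilde G"
      "\<And>Q. Q \<in> B_tilde G \<Longrightarrow> orlicz_functional \<phi> \<mu> K' \<le> orlicz_functional \<phi> \<mu> Q"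
      and lim: "(\<lambda>i. orlicz_functional \<phi> (\<mu>s (s (t i))) (M (s (t i)))) \<longlonglongrightarrow> orlicz_functional \<phi> \<mu> K'"
      using minimizer_stability_subseq[of G c T "\<lambda>i. \<mu>s (s i)" \<mu> \<phi> "\<lambda>i. M (s i)",
          OF dim G growth fin nc sphere_weak_conv_subseq[OF weak s(1)] \<phi> M min'] by metis
    have eq: "orlicz_functional \<phi> \<mu> K' = orlicz_functional \<phi> \<mu> K"
      by (intro antisym K K')
    obtain N where "\<forall>i\<ge>N. dist (orlicz_functional \<phi> (\<mu>s (s (t i))) (M (s (t i)))) (orlicz_functional \<phi> \<mu> K) < e"
      using lim e(1) unfolding eq lim_sequentially by blast
    then have "dist (orlicz_functional \<phi> (\<mu>s (s (t N))) (M (s (t N)))) (orlicz_functional \<phi> \<mu> K) < e" by blast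
    then show False using s(2)[of "t N"] by (simp add: S_def)
  qed
  moreover have "(INF Q\<in>B_tilde G. orlicz_functional \<phi> \<mu> Q) = orlicz_functional \<phi> \<mu> K"
    using K by (intro cInf_eq_minimum) auto
  ultimately show ?thesis using K(1) by auto
qed

text \<open>
  The integral is continuous and strictly decreasing in \<open>\<eta>\<close>, with limits \<open>\<infinity>\<close> and \<open>0\<close>, so the
  infimum is attained exactly where it equals \<open>1\<close>.
\<close>
lemma Inf_scaled_integral_le_1:
  fixes G :: "real \<Rightarrow> 'a::euclidean_space \<Rightarrow> real" and f :: "'a \<Rightarrow> real"
  assumes dim: "DIM('a) \<ge> 2" and G: "G \<in> class_GI"
    and growth: "c > 0" "T > 0" "\<And>t u. t \<ge> T \<Longrightarrow> u \<in> sphere 0 1 \<Longrightarrow> c * t ^ (DIM('a) - 1) \<le> G t u"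
    and f: "continuous_on (sphere 0 1) f" "\<And>u. u \<in> sphere 0 1 \<Longrightarrow> f u > 0"
  defines "F \<equiv> \<lambda>\<eta>. \<integral>u. G (f u / \<eta>) u \<partial>spherical_measure"
  shows "Inf {\<eta>. \<eta> > 0 \<and> F \<eta> \<le> 1} > 0" (is ?pos)
    and "\<eta> > 0 \<Longrightarrow> Inf {\<eta>. \<eta> > 0 \<and> F \<eta> \<le> 1} = \<eta> \<longleftrightarrow> F \<eta> = 1"
proof -
  let ?\<sigma> = "spherical_measure :: 'a measure"
  note fin = finite_sphere_measure_spherical[where 'a='a]
  interpret finite_measure ?\<sigma> by (rule finite_measure_spherical)
  define m where "m = DIM('a) - 1"
  have m: "m > 0" using dim by (simp add: m_def)
  have ne: "sphere (0::'a) 1 \<noteq> {}" by simp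
  obtain z where z: "z \<in> sphere 0 1" "\<And>u. u \<in> sphere 0 1 \<Longrightarrow> f z \<le> f u"
    using continuous_attains_inf[OF compact_sphere ne f(1)] by blast
  obtain b where b: "b > 0" "\<And>u. u \<in> sphere 0 1 \<Longrightarrow> \<bar>f u\<bar> \<le> b"
    using continuous_on_sphere_bounded[OF f(1)] by blast
  define a where "a = f z"
  have a: "a > 0" "\<And>u. u \<in> sphere 0 1 \<Longrightarrow> a \<le> f u" using z f(2) by (auto simp: a_def)
  have fc: "continuous_on (sphere 0 1) (\<lambda>u. f u / \<eta>)" "\<And>u. u \<in> sphere 0 1 \<Longrightarrow> f u / \<eta> > 0"
    if "\<eta> > 0" for \<eta>
    using that f by (auto intro!: continuous_intros)
  have Gc: "continuous_on (sphere 0 1) (\<lambda>u. G (f u / \<eta>) u)" if "\<eta> > 0" for \<eta>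
    by (intro class_GI_continuous_comp[OF G] fc that)
  \<comment> \<open>Positive total mass, from the cap bound with \<open>N = 1\<close>; strict
    monotonicity of \<open>F\<close> rests on it.\<close>
  have mass: "measure ?\<sigma> (sphere 0 1) > 0"
  proof -
    obtain c' where c': "c' > 0" "\<And>(v::'a) N. norm v = 1 \<Longrightarrow> N \<ge> 1 \<Longrightarrow>
        ennreal (c' * (1 / real N) ^ m) \<le> emeasure ?\<sigma> (sphere 0 1 \<inter> cball v (1 / real N))"
      using spherical_measure_cap_ge[OF dim] unfolding m_def by blast
    have "ennreal c' \<le> emeasure ?\<sigma> (sphere 0 1 \<inter> cball z 1)" using c'(2)[of z 1] z by simp
    also have "\<dots> \<le> emeasure ?\<sigma> (space ?\<sigma>)" by (rule emeasure_space)
    finally show ?thesis using c'(1) by (simp add: emeasure_eq_measure)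
  qed
  have anti: "F \<eta>' < F \<eta>" if "0 < \<eta>" "\<eta> < \<eta>'" for \<eta> \<eta>'
    unfolding F_def
  proof (rule integral_less_AE_space)
    show "integrable ?\<sigma> (\<lambda>u. G (f u / \<eta>') u)" "integrable ?\<sigma> (\<lambda>u. G (f u / \<eta>) u)"
      using that by (intro integrable_on_sphere[OF fin] Gc; simp)+
    show "AE u in ?\<sigma>. G (f u / \<eta>') u < G (f u / \<eta>) u"
    proof (rule AE_I2)
      fix u :: 'a assume "u \<in> space ?\<sigma>"
      then have u: "u \<in> sphere 0 1" by simp
      show "G (f u / \<eta>') u < G (f u / \<eta>) u"
        using that f(2)[OF u] by (intro class_GI_less[OF G _ _ u]) (auto intro: divide_strict_left_mono)
    qed
    show "emeasure ?\<sigma> (space ?\<sigma>) \<noteq> 0" using mass by (simp add: emeasure_eq_measure)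
  qed
  have cont: "continuous_on {l..h} F" if l: "0 < l" for l h
    unfolding continuous_on_sequentially F_def o_def
  proof safe
    fix x :: "nat \<Rightarrow> real" and y assume x: "\<forall>n. x n \<in> {l..h}" and y: "y \<in> {l..h}" and xy: "x \<longlonglongrightarrow> y"
    show "(\<lambda>n. \<integral>u. G (f u / x n) u \<partial>?\<sigma>) \<longlonglongrightarrow> (\<integral>u. G (f u / y) u \<partial>?\<sigma>)"
    proof (rule class_GI_integral_tendsto[OF G fin, where a = "a / h" and b = "b / l"])
      have x': "l \<le> x n" "x n \<le> h" for n using x by auto
      show "continuous_on (sphere 0 1) (\<lambda>u. f u / x n)" for n
        using x'[of n] l by (intro fc) auto
      show "continuous_on (sphere 0 1) (\<lambda>u. f u / y)" using y l by (intro fc) auto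
      show "0 < a / h" using a y l by auto
      show "a / h \<le> f u / x n \<and> f u / x n \<le> b / l" if u: "u \<in> sphere 0 1" for n u
      proof
        show "a / h \<le> f u / x n" using a(1) a(2)[OF u] x'[of n] l by (intro frac_le) auto
        show "f u / x n \<le> b / l" using b(1) b(2)[OF u] x'[of n] l by (intro frac_le) auto
      qed
      show "(\<lambda>n. f u / x n) \<longlonglongrightarrow> f u / y" for u
        using y l by (intro tendsto_intros xy) auto
    qed
  qed
  have "(\<lambda>n. F (real (Suc n))) \<longlonglongrightarrow> (\<integral>u. 0 \<partial>?\<sigma>)"
    unfolding F_def
  proof (rule integral_dominated_convergence[where w = "\<lambda>u. G (f u / 1) u"])
    show "integrable ?\<sigma> (\<lambda>u. G (f u / 1) u)" by (intro integrable_on_sphere[OF fin] Gc) simp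
    show "(\<lambda>u. G (f u / real (Suc n)) u) \<in> borel_measurable ?\<sigma>" for n
      by (intro borel_measurable_on_sphere[OF fin] Gc) simp
    show "AE u in ?\<sigma>. norm (G (f u / real (Suc n)) u) \<le> G (f u / 1) u" for n
    proof (rule AE_I2)
      fix u :: 'a assume "u \<in> space ?\<sigma>"
      then have u: "u \<in> sphere 0 1" by simp
      have "0 < f u / real (Suc n)" "f u / real (Suc n) \<le> f u / 1"
        using f(2)[OF u] by (auto intro!: divide_left_mono simp del: of_nat_Suc simp add: divide_le_eq)
      then show "norm (G (f u / real (Suc n)) u) \<le> G (f u / 1) u"
        using class_GI_pos[OF G _ u, of "f u / real (Suc n)"]
          class_GI_le[OF G _ _ u, of "f u / real (Suc n)" "f u / 1"] by simp
    qed
    show "AE u in ?\<sigma>. (\<lambda>n. G (f u / real (Suc n)) u) \<longlonglongrightarrow> 0"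
    proof (rule AE_I2)
      fix u :: 'a assume "u \<in> space ?\<sigma>"
      then have u: "u \<in> sphere 0 1" by simp
      have "(\<lambda>n. f u / real (Suc n)) \<longlonglongrightarrow> 0" by (rule LIMSEQ_Suc[OF lim_const_over_n])
      then have "filterlim (\<lambda>n. f u / real (Suc n)) (at_right 0) sequentially"
        using f(2)[OF u] by (auto simp: filterlim_at intro!: always_eventually simp del: of_nat_Suc)
      then show "(\<lambda>n. G (f u / real (Suc n)) u) \<longlonglongrightarrow> 0"
        by (rule filterlim_compose[OF class_GI_tendsto_0[OF G u]])
    qed
  qed simp
  then have "(\<lambda>n. F (real (Suc n))) \<longlonglongrightarrow> 0" by simp
  then have "\<forall>\<^sub>F n in sequentially. F (real (Suc n)) < 1" by (rule order_tendstoD) simp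
  then obtain n where n: "F (real (Suc n)) < 1" by (auto simp: eventually_sequentially)
  \<comment> \<open>\<open>H\<close> is chosen so that growth applies (\<open>H \<ge> T\<close>), so
    that \<open>H ^ m \<ge> H\<close> (\<open>H \<ge> 1\<close>), and so that \<open>c * H\<close>
    has integral at least 1. With \<open>l \<le> a / H\<close> the argument \<open>f u / l\<close>
    is at least \<open>H\<close>, and \<open>l \<le> 1\<close> puts \<open>l\<close> to the left of
    \<open>Suc n\<close> for the intermediate value theorem.\<close>
  define H where "H = max T 1 + 1 / (c * measure ?\<sigma> (sphere 0 1))"
  define l where "l = min (a / H) 1"
  have H: "H \<ge> T" "H \<ge> 1" "H > 0" "H \<ge> 1 / (c * measure ?\<sigma> (sphere 0 1))"
  proof -
    have "1 / (c * measure ?\<sigma> (sphere 0 1)) \<ge> 0" using growth(1) mass by simp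
    then show "H \<ge> T" "H \<ge> 1" "H > 0" "H \<ge> 1 / (c * measure ?\<sigma> (sphere 0 1))"
      using max.cobounded1[of T 1] max.cobounded2[of 1 T] unfolding H_def by linarith+
  qed
  have l: "l > 0" "l \<le> 1" "H \<le> a / l"
  proof -
    show l0: "l > 0" "l \<le> 1" using a H by (auto simp: l_def)
    have "l \<le> a / H" by (simp add: l_def)
    then show "H \<le> a / l" using l0 H by (simp add: field_simps)
  qed
  have "1 \<le> F l"
  proof -
    have "1 \<le> measure ?\<sigma> (sphere 0 1) * (c * H)"
      using H(4) growth(1) mass by (simp add: field_simps)
    also have "\<dots> = (\<integral>u. c * H \<partial>?\<sigma>)" by (rule integral_const_on_sphere[OF fin, symmetric])
    also have "\<dots> \<le> F l"
      unfolding F_def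
    proof (rule integral_mono_on_sphere[OF fin continuous_on_const Gc[OF l(1)]])
      fix u :: 'a assume u: "u \<in> sphere 0 1"
      have "a / l \<le> f u / l" using a(2)[OF u] l by (intro divide_right_mono) auto
      then have Hf: "H \<le> f u / l" using l(3) by linarith
      have "H ^ 1 \<le> H ^ m" using H m by (intro power_increasing) auto
      also have "\<dots> \<le> (f u / l) ^ m" using H Hf by (intro power_mono) auto
      finally have "c * H \<le> c * (f u / l) ^ m" using growth(1) by simp
      also have "\<dots> \<le> G (f u / l) u" unfolding m_def using H Hf by (intro growth u) linarith
      finally show "c * H \<le> G (f u / l) u" .
    qed
    finally show ?thesis .
  qed
  then obtain \<eta>0 where \<eta>0: "l \<le> \<eta>0" "F \<eta>0 = 1"
    using IVT2'[of F "real (Suc n)" 1 l] cont[OF l(1)] n l(2) by force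
  have \<eta>0': "\<eta>0 > 0" using \<eta>0 l by linarith
  have iff: "\<eta> > 0 \<and> F \<eta> \<le> 1 \<longleftrightarrow> \<eta>0 \<le> \<eta>" for \<eta>
    using anti[of \<eta> \<eta>0] anti[of \<eta>0 \<eta>] \<eta>0 \<eta>0' by (cases \<eta> \<eta>0 rule: linorder_cases) auto
  have "{\<eta>. \<eta> > 0 \<and> F \<eta> \<le> 1} = {\<eta>0..}" using iff by auto
  then have Inf: "Inf {\<eta>. \<eta> > 0 \<and> F \<eta> \<le> 1} = \<eta>0" by simp
  then show ?pos using \<eta>0' by simp
  show "Inf {\<eta>. \<eta> > 0 \<and> F \<eta> \<le> 1} = \<eta> \<longleftrightarrow> F \<eta> = 1" if "\<eta> > 0"
    unfolding Inf using anti[of \<eta> \<eta>0] anti[of \<eta>0 \<eta>] \<eta>0 \<eta>0' that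
    by (cases \<eta> \<eta>0 rule: linorder_cases) auto
qed

lemma class_GI_rescale:
  assumes G: "G \<in> class_GI" and \<eta>: "\<eta> > 0"
  shows "(\<lambda>t u. G (t / \<eta>) u) \<in> class_GI"
  unfolding class_GI_def
proof (intro CollectI conjI allI ballI impI)
  show "G (t / \<eta>) u > 0" if "t > 0" "u \<in> sphere 0 1" for t u
    using that \<eta> by (intro class_GI_pos[OF G]) auto
  have "continuous_on ({0<..} \<times> sphere 0 1) (\<lambda>p. (fst p / \<eta>, snd p))"
    using \<eta> by (intro continuous_intros) auto
  moreover have "(\<lambda>p. (fst p / \<eta>, snd p)) ` ({0<..} \<times> sphere 0 1) \<subseteq> {0<..} \<times> sphere 0 1"
    using \<eta> by auto
  ultimately show "continuous_on ({0<..} \<times> sphere 0 1) (\<lambda>(t, u). G (t / \<eta>) u)"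
    using continuous_on_compose2[OF class_GI_continuous[OF G],
        of "{0<..} \<times> sphere 0 1" "\<lambda>p. (fst p / \<eta>, snd p)"]
    by (simp add: split_def)
  fix u :: 'a assume u: "u \<in> sphere 0 1"
  show "strict_mono_on {0<..} (\<lambda>t. G (t / \<eta>) u)"
    using \<eta> by (intro strict_mono_onI class_GI_less[OF G _ _ u]) (auto intro: divide_strict_right_mono)
  have "filterlim (\<lambda>t. t / \<eta>) (at_right 0) (at_right 0)"
  proof -
    have "((\<lambda>t. t / \<eta>) \<longlongrightarrow> 0 / \<eta>) (at_right 0)" using \<eta> by (intro tendsto_intros) auto
    then show ?thesis using \<eta> by (auto simp: filterlim_at eventually_at_filter)
  qed
  then show "((\<lambda>t. G (t / \<eta>) u) \<longlongrightarrow> 0) (at_right 0)"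
    by (rule filterlim_compose[OF class_GI_tendsto_0[OF G u]])
  have "filterlim (\<lambda>t. 1 / \<eta> * t) at_top at_top"
    using \<eta> by (intro filterlim_tendsto_pos_mult_at_top[OF tendsto_const] filterlim_ident) auto
  then have "filterlim (\<lambda>t. t / \<eta>) at_top at_top" by simp
  moreover have "filterlim (\<lambda>t. G t u) at_top at_top" using G u by (simp add: class_GI_def)
  ultimately show "filterlim (\<lambda>t. G (t / \<eta>) u) at_top at_top"
    by (rule filterlim_compose[rotated])
qed

text \<open>Both the polar of \<open>Q\<close> and the ball have homogeneous dual volume
  \<open>\<eta>\<close> exactly when their integrals of \<open>G\<close> scaled by
  \<open>\<eta>\<close> equal 1. For the ball this holds by the choice of \<open>\<eta>\<close>, so
  the condition on \<open>Q\<close> says that its integral equals that of the ball.\<close>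

lemma B_hat_eq_B_tilde:
  fixes G :: "real \<Rightarrow> 'a::euclidean_space \<Rightarrow> real"
  assumes dim: "DIM('a) \<ge> 2" and G: "G \<in> class_GI"
    and growth: "c > 0" "T > 0" "\<And>t u. t \<ge> T \<Longrightarrow> u \<in> sphere 0 1 \<Longrightarrow> c * t ^ (DIM('a) - 1) \<le> G t u"
  obtains \<eta> where "\<eta> > 0" "B_hat G = B_tilde (\<lambda>t u. G (t / \<eta>) u)"
proof -
  let ?\<sigma> = "spherical_measure :: 'a measure"
  define \<eta> where "\<eta> = hom_dual_vol G (cball 0 1)"
  have "(\<integral>u. G (radial_fun (cball 0 1) u / x) u \<partial>?\<sigma>) = (\<integral>u. G (1 / x) u \<partial>?\<sigma>)" for x
    by (intro Bochner_Integration.integral_cong) (auto simp: radial_fun_cball)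
  then have \<eta>_eq: "\<eta> = Inf {\<eta>. \<eta> > 0 \<and> (\<integral>u. G (1 / \<eta>) u \<partial>?\<sigma>) \<le> 1}"
    by (simp add: \<eta>_def hom_dual_vol_def)
  note one = Inf_scaled_integral_le_1[OF dim G growth, of "\<lambda>_. 1"]
  have \<eta>: "\<eta> > 0" unfolding \<eta>_eq by (rule one(1)) auto
  \<comment> \<open>The criterion is applied at the infimum itself, where its left side is an
    identity.\<close>
  have one': "(\<integral>u. G (1 / \<eta>) u \<partial>?\<sigma>) = 1"
    using one(2)[OF _ _ _ _ \<eta>] unfolding \<eta>_eq[symmetric] by auto
  have "hom_dual_vol G (polar_body Q) = \<eta> \<longleftrightarrow> (\<integral>u. G (1 / support_fun Q u / \<eta>) u \<partial>?\<sigma>) = 1"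
    if Q: "Q \<in> bodies_o" for Q
  proof -
    have "(\<integral>u. G (radial_fun (polar_body Q) u / x) u \<partial>?\<sigma>) = (\<integral>u. G (1 / support_fun Q u / x) u \<partial>?\<sigma>)" for x
    proof (rule Bochner_Integration.integral_cong[OF refl])
      fix u :: 'a assume "u \<in> space ?\<sigma>"
      then have "u \<noteq> 0" by auto
      then show "G (radial_fun (polar_body Q) u / x) u = G (1 / support_fun Q u / x) u"
        by (simp add: radial_fun_polar_body[OF Q])
    qed
    then have "hom_dual_vol G (polar_body Q) =
        Inf {\<eta>. \<eta> > 0 \<and> (\<integral>u. G (1 / support_fun Q u / \<eta>) u \<partial>?\<sigma>) \<le> 1}"
      by (simp only: hom_dual_vol_def)
    moreover have "continuous_on (sphere 0 1) (\<lambda>u. 1 / support_fun Q u)"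
      using support_fun_pos_sphere[OF Q]
      by (intro continuous_intros continuous_on_support_fun[OF bodies_oD(1,5)[OF Q]]) force
    moreover have "1 / support_fun Q u > 0" if "u \<in> sphere 0 1" for u
      using support_fun_pos_sphere[OF Q that] by simp
    ultimately show ?thesis
      using Inf_scaled_integral_le_1(2)[OF dim G growth, of "\<lambda>u. 1 / support_fun Q u" \<eta>] \<eta> by simp
  qed
  then have "Q \<in> B_hat G \<longleftrightarrow> Q \<in> B_tilde (\<lambda>t u. G (t / \<eta>) u)" for Q
    unfolding B_hat_def \<eta>_def[symmetric] B_tilde_iff one' by blast
  then have "B_hat G = B_tilde (\<lambda>t u. G (t / \<eta>) u)" by blast
  then show ?thesis using \<eta> that by blast
qed

theorem theorem4p6:
  fixes \<mu>s :: "nat \<Rightarrow> 'a::euclidean_space measure"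
    and \<mu> :: "'a measure"
    and G :: "real \<Rightarrow> 'a \<Rightarrow> real"
    and \<phi> :: "real \<Rightarrow> real"
    and q :: real
  assumes "DIM('a) \<ge> 2"
    and "\<And>i. finite_sphere_measure (\<mu>s i)" and "\<And>i. not_conc_hemisphere (\<mu>s i)"
    and "finite_sphere_measure \<mu>" and "not_conc_hemisphere \<mu>"
    and "sphere_weak_conv \<mu>s \<mu>"
    and "G \<in> class_GI"
    and "q \<ge> real DIM('a) - 1"
    and "Inf {G t u / t powr q | t u. t \<ge> 1 \<and> u \<in> sphere 0 1} > 0"
    and "\<phi> \<in> class_I"
  shows
    "(\<forall>M. (\<forall>i. M i \<in> B_tilde G \<and>
              orlicz_functional \<phi> (\<mu>s i) (M i) = (INF Q\<in>B_tilde G. orlicz_functional \<phi> (\<mu>s i) Q))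
        \<longrightarrow> (\<exists>M'\<in>B_tilde G.
              orlicz_functional \<phi> \<mu> M' = (INF Q\<in>B_tilde G. orlicz_functional \<phi> \<mu> Q) \<and>
              (\<lambda>i. orlicz_functional \<phi> (\<mu>s i) (M i)) \<longlonglongrightarrow> orlicz_functional \<phi> \<mu> M'))
   \<and> (\<forall>M. (\<forall>i. M i \<in> B_hat G \<and>
              orlicz_functional \<phi> (\<mu>s i) (M i) = (INF Q\<in>B_hat G. orlicz_functional \<phi> (\<mu>s i) Q))
        \<longrightarrow> (\<exists>M'\<in>B_hat G.
              orlicz_functional \<phi> \<mu> M' = (INF Q\<in>B_hat G. orlicz_functional \<phi> \<mu> Q) \<and>
              (\<lambda>i. orlicz_functional \<phi> (\<mu>s i) (M i)) \<longlonglongrightarrow> orlicz_functional \<phi> \<mu> M'))"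
proof -
  note dim = assms(1) and fin = assms(2,4) and nc = assms(5) and weak = assms(6)
    and G = assms(7) and q = assms(8) and \<phi> = assms(10)
  let ?S = "{G t u / t powr q | t u. t \<ge> 1 \<and> u \<in> sphere 0 1}"
  define c where "c = Inf ?S"
  have c: "c > 0" using assms(9) by (simp add: c_def)
  define m where "m = DIM('a) - 1"
  have growth: "c * t ^ m \<le> G t u" if t: "t \<ge> 1" and u: "u \<in> sphere 0 1" for t u
  proof -
    \<comment> \<open>The real \<open>Inf\<close> bounds its set from below only when some lower
      bound exists; positivity of \<open>G\<close> provides 0.\<close>
    have "bdd_below ?S"
    proof (rule bdd_belowI)
      fix y assume "y \<in> ?S"
      then obtain s w where y: "y = G s w / s powr q" and s: "s \<ge> 1" "w \<in> sphere 0 1" by blast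
      have "G s w > 0" using s by (intro class_GI_pos[OF G]) auto
      then show "0 \<le> y" by (simp add: y)
    qed
    then have "c \<le> G t u / t powr q" unfolding c_def using t u by (intro cInf_lower) auto
    then have "c * t powr q \<le> G t u" using t by (simp add: field_simps)
    moreover have "t ^ m = t powr real m" using t by (simp add: powr_realpow)
    moreover have "t powr real m \<le> t powr q" using t q by (intro powr_mono) (auto simp: m_def)
    ultimately show ?thesis using c by (smt (verit) mult_left_mono)
  qed
  obtain \<eta> where \<eta>: "\<eta> > 0" "B_hat G = B_tilde (\<lambda>t u. G (t / \<eta>) u)"
    using B_hat_eq_B_tilde[OF dim G c zero_less_one] growth unfolding m_def by metis
  \<comment> \<open>Rescaling moves the growth threshold from 1 to \<open>\<eta>\<close>, which is
    why the lemmas carry a general threshold \<open>T\<close>.\<close>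
  have growth': "c / \<eta> ^ m * t ^ m \<le> G (t / \<eta>) u" if "t \<ge> \<eta>" "u \<in> sphere 0 1" for t u
    using growth[of "t / \<eta>" u] that \<eta>(1) by (simp add: power_divide)
  have c': "c / \<eta> ^ m > 0" using c \<eta> by simp
  have tilde: "\<exists>M'\<in>B_tilde G. orlicz_functional \<phi> \<mu> M' = (INF Q\<in>B_tilde G. orlicz_functional \<phi> \<mu> Q) \<and>
      (\<lambda>i. orlicz_functional \<phi> (\<mu>s i) (M i)) \<longlonglongrightarrow> orlicz_functional \<phi> \<mu> M'"
    if "\<forall>i. M i \<in> B_tilde G \<and>
      orlicz_functional \<phi> (\<mu>s i) (M i) = (INF Q\<in>B_tilde G. orlicz_functional \<phi> (\<mu>s i) Q)" for M
    using that growth unfolding m_def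
    by (intro minimizer_stability[OF dim G c zero_less_one _ fin nc weak \<phi>]) auto
  have hat: "\<exists>M'\<in>B_hat G. orlicz_functional \<phi> \<mu> M' = (INF Q\<in>B_hat G. orlicz_functional \<phi> \<mu> Q) \<and>
      (\<lambda>i. orlicz_functional \<phi> (\<mu>s i) (M i)) \<longlonglongrightarrow> orlicz_functional \<phi> \<mu> M'"
    if "\<forall>i. M i \<in> B_hat G \<and>
      orlicz_functional \<phi> (\<mu>s i) (M i) = (INF Q\<in>B_hat G. orlicz_functional \<phi> (\<mu>s i) Q)" for M
    using that growth' unfolding m_def \<eta>(2)
    by (intro minimizer_stability[OF dim class_GI_rescale[OF G \<eta>(1)] c'[unfolded m_def] \<eta>(1) _ fin nc weak \<phi>]) auto
  show ?thesis using tilde hat by blast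
qed

end
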